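(* Let $T=\pi$. Let $f:\mathbb{R}\times\mathbb{R}\to\mathbb{R}$, $(x,u)\mapsto f(x,u)$, be such that: (1) $f$ and its partial derivative $f_u$ are Carathéodory functions on $\mathbb{R}\times\mathbb{R}$, and $f(x+\pi,u)=f(x,u)$ for all $(x,u)\in\mathbb{R}\times\mathbb{R}$; (2) there exist functions $\alpha,\beta\in L^\infty(0,\pi)$ satisfying $0\prec\alpha$ and $$\alpha(x)\le f_u(x,u)\le\beta(x)\ \text{ for a.e. }x\in(0,\pi)\text{ and all }u\in\mathbb{R};$$ (3) there exists $x_0\in(0,\pi)$ such that $$\max\left\{x_0^2\,\|\beta\|_{L^\infty(0,x_0)},\ (\pi-x_0)^2\,\|\beta\|_{L^\infty(x_0,\pi)}\right\}<\pi^2.$$ Then the problem $$u''(x)+f(x,u(x))=0,\ x\in(0,\pi),\qquad u(0)-u(\pi)=u'(0)-u'(\pi)=0,$$ has a unique solution.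
   Context: $0\prec\alpha$ means $\alpha(x)\ge 0$ for a.e. $x\in[0,\pi]$ and $\alpha(x)>0$ on a set of positive measure. A function $g:\mathbb{R}\times\mathbb{R}\to\mathbb{R}$ is Carathéodory if $g(\cdot,u)$ is measurable for every $u$, $g(x,\cdot)$ is continuous for a.e. $x$, and for every $r>0$ there is a function $h_r$, integrable on bounded intervals, with $|g(x,u)|\le h_r(x)$ for a.e. $x$ and all $|u|\le r$. Solutions are $C^1$ functions on $[0,\pi]$ with absolutely continuous derivative satisfying the equation a.e. *)

theory Defs
  imports "HOL-Analysis.Analysis" "HOL-Probability.Essential_Supremum"
begin

definition positive_on_period :: "(real \<Rightarrow> real) \<Rightarrow> bool" where
  "positive_on_period \<alpha> \<longleftrightarrow>
     (AE x in lebesgue_on {0..pi}. 0 \<le> \<alpha> x) \<and>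
     0 < emeasure lebesgue {x \<in> {0..pi}. 0 < \<alpha> x}"

text \<open>The essential supremum is extended-real-valued because the library's \<open>esssup\<close>
  needs a complete linear order.\<close>

definition Linf_norm :: "real \<Rightarrow> real \<Rightarrow> (real \<Rightarrow> real) \<Rightarrow> ereal" where
  "Linf_norm a b g = esssup (lebesgue_on {a<..<b}) (\<lambda>x. ereal \<bar>g x\<bar>)"

definition Linf :: "real \<Rightarrow> real \<Rightarrow> (real \<Rightarrow> real) set" where
  "Linf a b = {g. g \<in> borel_measurable (lebesgue_on {a<..<b}) \<and> Linf_norm a b g < \<infinity>}"

definition caratheodory :: "(real \<Rightarrow> real \<Rightarrow> real) \<Rightarrow> bool" where
  "caratheodory g \<longleftrightarrow>
     (\<forall>u. (\<lambda>x. g x u) \<in> borel_measurable lebesgue) \<and>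
     (AE x in lebesgue. continuous_on UNIV (g x)) \<and>
     (\<forall>r>0. \<exists>h. (\<forall>a b. set_integrable lebesgue {a..b} h) \<and>
        (AE x in lebesgue. \<forall>u. \<bar>u\<bar> \<le> r \<longrightarrow> \<bar>g x u\<bar> \<le> h x))"

text \<open>Absolute continuity of a function on a compact interval; the library's
  \<open>absolutely_continuous\<close> is the relation between measures. The set \<open>D\<close> is a finite
  family of non-overlapping subintervals, each given by its pair of endpoints.\<close>

definition abs_cont_on :: "real \<Rightarrow> real \<Rightarrow> (real \<Rightarrow> real) \<Rightarrow> bool" where
  "abs_cont_on a b g \<longleftrightarrow>
     (\<forall>\<epsilon>>0. \<exists>\<delta>>0. \<forall>D. finite D \<and>
        (\<forall>(s, t)\<in>D. a \<le> s \<and> s < t \<and> t \<le> b) \<and>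
        pairwise (\<lambda>(s, t) (s', t'). disjnt {s<..<t} {s'<..<t'}) D \<and>
        (\<Sum>(s, t)\<in>D. t - s) < \<delta>
        \<longrightarrow> (\<Sum>(s, t)\<in>D. \<bar>g t - g s\<bar>) < \<epsilon>)"

text \<open>Here \<open>u'\<close> is the derivative of \<open>u\<close> on \<open>[0, \<pi>]\<close>, one-sided at the endpoints,
  and \<open>u2\<close> is the value of the second derivative at a point where it exists.\<close>

definition periodic_solution :: "(real \<Rightarrow> real \<Rightarrow> real) \<Rightarrow> (real \<Rightarrow> real) \<Rightarrow> bool" where
  "periodic_solution f u \<longleftrightarrow>
     (\<exists>u'. (\<forall>x\<in>{0..pi}. (u has_real_derivative u' x) (at x within {0..pi})) \<and>
        continuous_on {0..pi} u' \<and>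
        abs_cont_on 0 pi u' \<and>
        (AE x in lebesgue_on {0<..<pi}.
           \<exists>u2. (u' has_real_derivative u2) (at x) \<and> u2 + f x (u x) = 0) \<and>
        u 0 - u pi = 0 \<and> u' 0 - u' pi = 0)"

end

theory Submission
  imports Defs "HOL-Complex_Analysis.Great_Picard"
begin

text \<open>
  The difference \<open>w\<close> of two solutions of \<open>u'' + f(x, u) = 0\<close> solves a linear equation
  \<open>w'' + q w = 0\<close> with \<open>\<alpha> \<le> q \<le> \<beta>\<close>. Both uniqueness and existence come out of one linear fact
  in a quantitative form: no such equation has a nontrivial \<open>\<pi>\<close>-periodic solution.

  \<^bold>\<open>The linear fact.\<close> Let \<open>k\<^sub>1\<close> and \<open>k\<^sub>2\<close> bound \<open>\<beta>\<close> on the two sides of \<open>x\<^sub>0\<close>, and let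
  \<open>w\<^sub>1 = \<pi> / x\<^sub>0\<close> and \<open>w\<^sub>2 = \<pi> / (\<pi> - x\<^sub>0)\<close> be the frequencies for which the two intervals are
  exactly half a turn long. The third hypothesis says \<open>k\<^sub>1 < w\<^sub>1\<^sup>2\<close> and \<open>k\<^sub>2 < w\<^sub>2\<^sup>2\<close>. In the comparison
  equation \<open>\<phi>'' + w\<^sub>i\<^sup>2 \<phi> = 0\<close> each half turn maps Cauchy data to their negatives, so the
  period map is the identity: every solution \<open>\<phi>\<close> is \<open>\<pi>\<close>-periodic and has exactly two
  zeros per period, wherever the first one is placed. By Sturm's comparison theorem a strictly smaller
  \<open>q\<close> lets \<open>\<phi>\<close> vanish strictly between any two neighbouring zeros of \<open>w\<close>. A periodic \<open>w\<close>
  that changes sign has two zeros per period; the \<open>\<phi>\<close> that starts at one of them would need two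
  further zeros within the period, which is one too many. A periodic \<open>w\<close> of
  constant sign satisfies \<open>\<integral> q w = 0\<close>, hence vanishes almost everywhere on the set
  \<open>{\<alpha> > 0}\<close>, which has positive measure, although \<open>w\<close> has only finitely many zeros. This is
  \<open>periodic_admissible_zero\<close>.

  \<^bold>\<open>Making it uniform.\<close> The coefficient \<open>q\<close> depends on the two solutions and should not
  appear in the estimates. What is kept of the equation is a pair of inequalities bounding the
  increments of \<open>w'\<close> by integrals of \<open>w\<close> (the predicate \<open>admissible\<close>). They are preserved
  under uniform limits of \<open>(w, w')\<close> and under scaling, so the theorem of Arzela and Ascoli turns
  uniqueness into a constant \<open>c > 0\<close> with
  \<open>c (\<bar>w 0\<bar> + \<bar>w' 0\<bar>) \<le> \<bar>w \<pi> - w 0\<bar> + \<bar>w' \<pi> - w' 0\<bar>\<close>; this is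
  \<open>periodicity_defect_bound\<close>.

  \<^bold>\<open>Existence.\<close> The function \<open>f x\<close> is Lipschitz with a constant independent of \<open>x\<close>, so
  every initial value problem is solvable on all of \<open>[0, \<pi>]\<close>. The shooting map that sends initial
  data in \<open>\<real>\<^sup>2\<close> to the periodicity defect of their solution increases distances at least by a
  constant factor. Such a map is injective with closed range, and its range is open by
  invariance of domain, so it takes the value \<open>0\<close>.

  \<^bold>\<open>Solutions.\<close> The arguments above use the integrated equation. It is equivalent to the
  differential equation almost everywhere together with absolute continuity of \<open>u'\<close>, by the
  two halves of the fundamental theorem of calculus for the Lebesgue integral
  (\<open>abs_cont_on_fundamental_theorem\<close> and \<open>indefinite_integral_has_derivative_ae\<close>).
\<close>

section \<open>Absolute continuity, indefinite integrals and null sets\<close>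

lemma AE_lebesgue_on_iff_negligible:
  assumes S: "S \<in> sets lebesgue"
  shows "(AE x in lebesgue_on S. P x) \<longleftrightarrow> negligible {x \<in> S. \<not> P x}"
proof -
  have "(AE x in lebesgue_on S. P x) \<longleftrightarrow> (AE x in lebesgue. x \<in> S \<longrightarrow> P x)"
    using S by (intro AE_restrict_space_iff) simp
  also have "\<dots> \<longleftrightarrow> negligible {x \<in> S. \<not> P x}"
  proof
    assume "AE x in lebesgue. x \<in> S \<longrightarrow> P x"
    then obtain N where "N \<in> null_sets lebesgue" "{x \<in> space lebesgue. \<not> (x \<in> S \<longrightarrow> P x)} \<subseteq> N"
      unfolding eventually_ae_filter by blast
    then show "negligible {x \<in> S. \<not> P x}"
      unfolding negligible_iff_null_sets[symmetric] by (auto elim: negligible_subset)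
  next
    assume "negligible {x \<in> S. \<not> P x}"
    then show "AE x in lebesgue. x \<in> S \<longrightarrow> P x"
      unfolding negligible_iff_null_sets by (rule AE_I') auto
  qed
  finally show ?thesis .
qed

lemma has_integral_0_nonneg_negligible:
  fixes h :: "real \<Rightarrow> real"
  assumes S: "S \<in> sets lebesgue" and h: "(h has_integral 0) S" "\<And>x. x \<in> S \<Longrightarrow> 0 \<le> h x"
  shows "negligible {x \<in> S. h x \<noteq> 0}"
proof -
  have "h absolutely_integrable_on S"
    using h by (intro nonnegative_absolutely_integrable_1) (auto simp: has_integral_iff)
  then have int: "integrable (lebesgue_on S) h"
    using S by (simp add: absolutely_integrable_on_def set_integrable_def integrable_restrict_space scaleR_conv_of_real)
  then have "integral\<^sup>L (lebesgue_on S) h = 0"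
    using lebesgue_integral_eq_integral[OF int S] h(1) by (simp add: has_integral_iff)
  moreover have "AE x in lebesgue_on S. 0 \<le> h x"
    using h(2) by (intro AE_I2) (simp add: space_restrict_space)
  ultimately have "AE x in lebesgue_on S. h x = 0"
    using integral_nonneg_eq_0_iff_AE[OF int] by simp
  then show ?thesis
    using AE_lebesgue_on_iff_negligible[OF S] by simp
qed

lemma integral_pos_of_continuous:
  fixes h :: "real \<Rightarrow> real"
  assumes h: "continuous_on {s..t} h" "\<And>x. x \<in> {s..t} \<Longrightarrow> 0 \<le> h x"
    and p: "s < t" "p \<in> {s..t}" "0 < h p"
  shows "0 < integral {s..t} h"
proof -
  have int: "h integrable_on {s..t}" using h(1) by (rule integrable_continuous_real)
  have "0 \<le> integral {s..t} h" using h(2) by (intro integral_nonneg int) auto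
  moreover have "integral {s..t} h \<noteq> 0"
  proof
    assume "integral {s..t} h = 0"
    then have "(h has_integral 0) (cbox s t)" using int by (simp add: has_integral_iff)
    then have "h p = 0"
      by (rule has_integral_0_cbox_imp_0[rotated 2]) (use h p in auto)
    with p show False by simp
  qed
  ultimately show ?thesis by simp
qed

text \<open>Coefficients are only bounded and measurable; this is what makes their products with a
  continuous function integrable.\<close>

lemma continuous_mult_bounded_absolutely_integrable:
  fixes c w :: "real \<Rightarrow> real"
  assumes c: "c \<in> borel_measurable lebesgue" "\<And>x. \<bar>c x\<bar> \<le> C" and w: "continuous_on {s..t} w"
  shows "(\<lambda>x. c x * w x) absolutely_integrable_on {s..t}"
proof (rule measurable_bounded_by_integrable_imp_absolutely_integrable)
  have "c \<in> borel_measurable (lebesgue_on {s..t})"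
    using c(1) by (rule measurable_restrict_space1)
  moreover have "w \<in> borel_measurable (lebesgue_on {s..t})"
    using w by (rule continuous_imp_measurable_on_sets_lebesgue) simp
  ultimately show "(\<lambda>x. c x * w x) \<in> borel_measurable (lebesgue_on {s..t})"
    by (rule borel_measurable_times)
  show "(\<lambda>x. C * \<bar>w x\<bar>) integrable_on {s..t}"
    by (intro integrable_continuous_real continuous_intros w)
  show "norm (c x * w x) \<le> C * \<bar>w x\<bar>" for x
    using c(2)[of x] by (simp add: abs_mult mult_right_mono)
qed simp

text \<open>The one-sided statement is the differentiation theorem for averages over \<open>[x, x + r]\<close>, written
  as a first-order expansion so that it can be combined with its mirror image.\<close>

lemma indefinite_integral_right_derivative_ae:
  fixes h :: "real \<Rightarrow> real"
  assumes "\<And>a b. h integrable_on {a..b}"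
  obtains N where "negligible N"
    "\<And>x e. x \<notin> N \<Longrightarrow> 0 < e \<Longrightarrow>
       \<exists>d>0. \<forall>y. x \<le> y \<and> y < x + d \<longrightarrow> \<bar>integral {x..y} h - h x * (y - x)\<bar> \<le> e * (y - x)"
proof -
  obtain N where N: "negligible N"
    and d: "\<And>x e. x \<notin> N \<Longrightarrow> 0 < e \<Longrightarrow> \<exists>d>0. \<forall>r. 0 < r \<and> r < d \<longrightarrow>
              norm (integral (cbox x (x + r *\<^sub>R One)) h /\<^sub>R r ^ DIM(real) - h x) < e"
    using integrable_ccontinuous_explicit[of h] assms by (metis box_real(2))
  show thesis
  proof (rule that[OF N])
    fix x e :: real
    assume "x \<notin> N" "0 < e"
    then obtain d where "d > 0"
      and d: "\<And>r. 0 < r \<Longrightarrow> r < d \<Longrightarrow> \<bar>integral {x..x + r} h / r - h x\<bar> < e"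
      using d[of x e] by (auto simp: divide_inverse_commute)
    have "\<bar>integral {x..y} h - h x * (y - x)\<bar> \<le> e * (y - x)" if "x \<le> y" "y < x + d" for y
    proof (cases "y = x")
      case False
      with that d[of "y - x"] have "\<bar>integral {x..y} h / (y - x) - h x\<bar> * (y - x) \<le> e * (y - x)"
        by (intro mult_right_mono) auto
      moreover have "\<bar>integral {x..y} h / (y - x) - h x\<bar> * (y - x)
          = \<bar>(integral {x..y} h / (y - x) - h x) * (y - x)\<bar>"
        using that by (simp add: abs_mult)
      moreover have "(integral {x..y} h / (y - x) - h x) * (y - x) = integral {x..y} h - h x * (y - x)"
        using False by (simp add: field_simps)
      ultimately show ?thesis by simp
    qed simp
    with \<open>d > 0\<close> show "\<exists>d>0. \<forall>y. x \<le> y \<and> y < x + d \<longrightarrow>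
        \<bar>integral {x..y} h - h x * (y - x)\<bar> \<le> e * (y - x)" by blast
  qed
qed

text \<open>Lebesgue's differentiation theorem on the line. The derivative from the left at \<open>x\<close> is the
  derivative from the right at \<open>- x\<close> of the indefinite integral of the reflected function.\<close>

lemma indefinite_integral_has_derivative_ae:
  fixes h :: "real \<Rightarrow> real"
  assumes h: "h integrable_on {a..b}"
    and F: "\<And>s t. a \<le> s \<Longrightarrow> s \<le> t \<Longrightarrow> t \<le> b \<Longrightarrow> F t - F s = integral {s..t} h"
  obtains N where "negligible N"
    "\<And>x. x \<in> {a<..<b} - N \<Longrightarrow> (F has_real_derivative h x) (at x)"
proof -
  define g where "g = (\<lambda>x. if x \<in> {a..b} then h x else 0)"
  have g: "g integrable_on {c..d}" for c d
    unfolding g_def using integrable_altD(1)[OF h, of c d] by simp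
  have g': "(\<lambda>x. g (- x)) integrable_on {c..d}" for c d
    using g[of "-d" "-c"] Henstock_Kurzweil_Integration.integrable_reflect_real[of g "-c" "-d"] by simp
  obtain N1 where N1: "negligible N1"
    and r: "\<And>x e. x \<notin> N1 \<Longrightarrow> 0 < e \<Longrightarrow>
       \<exists>d>0. \<forall>y. x \<le> y \<and> y < x + d \<longrightarrow> \<bar>integral {x..y} g - g x * (y - x)\<bar> \<le> e * (y - x)"
    using indefinite_integral_right_derivative_ae[OF g] by metis
  obtain N2 where N2: "negligible N2"
    and l: "\<And>x e. x \<notin> N2 \<Longrightarrow> 0 < e \<Longrightarrow>
       \<exists>d>0. \<forall>y. x \<le> y \<and> y < x + d \<longrightarrow>
         \<bar>integral {x..y} (\<lambda>x. g (- x)) - g (- x) * (y - x)\<bar> \<le> e * (y - x)"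
    using indefinite_integral_right_derivative_ae[OF g'] by metis
  show thesis
  proof (rule that)
    show "negligible (N1 \<union> uminus ` N2)"
      using N1 N2
      by (intro negligible_Un negligible_differentiable_image_negligible[OF order_refl])
        (auto intro!: derivative_intros differentiable_on_minus)
    fix x assume x: "x \<in> {a<..<b} - (N1 \<union> uminus ` N2)"
    then have "x \<notin> N1" "- x \<notin> N2" by force+
    have F_g: "F t - F s = integral {s..t} g" if "a \<le> s" "s \<le> t" "t \<le> b" for s t
      using F[OF that] that by (auto simp: g_def intro!: integral_cong)
    show "(F has_real_derivative h x) (at x)"
      unfolding has_field_derivative_def has_derivative_at_alt
    proof (intro conjI allI impI)
      fix e :: real assume "0 < e"
      obtain d1 where "d1 > 0" and d1: "\<And>y. x \<le> y \<Longrightarrow> y < x + d1 \<Longrightarrow>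
          \<bar>integral {x..y} g - g x * (y - x)\<bar> \<le> e * (y - x)"
        using r[OF \<open>x \<notin> N1\<close> \<open>0 < e\<close>] by blast
      obtain d2 where "d2 > 0" and d2: "\<And>y. - x \<le> y \<Longrightarrow> y < - x + d2 \<Longrightarrow>
          \<bar>integral {-x..y} (\<lambda>x. g (- x)) - g x * (y + x)\<bar> \<le> e * (y + x)"
        using l[OF \<open>- x \<notin> N2\<close> \<open>0 < e\<close>] by auto
      define d where "d = Min {d1, d2, x - a, b - x}"
      have "d > 0" using \<open>d1 > 0\<close> \<open>d2 > 0\<close> x by (auto simp: d_def)
      moreover have "norm (F y - F x - h x * (y - x)) \<le> e * norm (y - x)" if y: "norm (y - x) < d" for y
      proof -
        have *: "g x = h x" using x by (auto simp: g_def)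
        have yd: "\<bar>y - x\<bar> < d1" "\<bar>y - x\<bar> < d2" "a \<le> y" "y \<le> b"
          using y by (auto simp: d_def)
        show ?thesis
        proof (cases "x \<le> y")
          case True
          then show ?thesis using d1[of y] F_g[of x y] yd x * by auto
        next
          case False
          have "integral {-x..-y} (\<lambda>x. g (- x)) = integral {y..x} g"
            using Henstock_Kurzweil_Integration.integral_reflect_real[of x y g] by simp
          then have "\<bar>(F x - F y) - h x * (x - y)\<bar> \<le> e * (x - y)"
            using d2[of "- y"] F_g[of y x] yd x * False by (auto simp: algebra_simps)
          then show ?thesis using False by (auto simp: algebra_simps)
        qed
      qed
      ultimately show "\<exists>d>0. \<forall>y. norm (y - x) < d \<longrightarrow> norm (F y - F x - h x * (y - x)) \<le> e * norm (y - x)"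
        by blast
    qed (rule bounded_linear_mult_right)
  qed
qed

text \<open>Cut \<open>\<bar>h\<bar>\<close> at a height \<open>n\<close>. The part above \<open>n\<close> has a small integral over the whole interval, and
  the part below contributes at most \<open>n\<close> times the total length of the family.\<close>

lemma abs_cont_on_indefinite_integral:
  fixes h :: "real \<Rightarrow> real"
  assumes h: "h absolutely_integrable_on {a..b}"
    and F: "\<And>s t. a \<le> s \<Longrightarrow> s \<le> t \<Longrightarrow> t \<le> b \<Longrightarrow> F t - F s = integral {s..t} h"
  shows "abs_cont_on a b F"
  unfolding abs_cont_on_def
proof (intro allI impI)
  fix \<epsilon> :: real assume "\<epsilon> > 0"
  have habs: "(\<lambda>x. \<bar>h x\<bar>) absolutely_integrable_on {a..b}"
    using absolutely_integrable_norm[OF h] by (simp add: o_def)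
  define r where "r = (\<lambda>n::nat. \<lambda>x. max 0 (\<bar>h x\<bar> - real n))"
  have r_int: "r n absolutely_integrable_on {a..b}" for n
    unfolding r_def
    by (intro absolutely_integrable_max_1 set_integral_diff habs) (auto simp flip: box_real)
  have "(\<lambda>n. integral {a..b} (r n)) \<longlonglongrightarrow> integral {a..b} (\<lambda>x. 0)"
  proof (rule dominated_convergence(2)[where h="\<lambda>x. \<bar>h x\<bar>"])
    show "r n integrable_on {a..b}" for n
      using r_int set_lebesgue_integral_eq_integral(1) by blast
    show "(\<lambda>x. \<bar>h x\<bar>) integrable_on {a..b}"
      using habs set_lebesgue_integral_eq_integral(1) by blast
    show "norm (r n x) \<le> \<bar>h x\<bar>" for n x by (auto simp: r_def)
    show "(\<lambda>n. r n x) \<longlonglongrightarrow> 0" for x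
    proof (rule tendsto_eventually)
      obtain m :: nat where "\<bar>h x\<bar> \<le> real m" using real_arch_simple by blast
      then show "\<forall>\<^sub>F n in sequentially. r n x = 0"
        by (intro eventually_sequentiallyI[of m]) (auto simp: r_def)
    qed
  qed
  then have "\<forall>\<^sub>F n in sequentially. integral {a..b} (r n) < \<epsilon> / 2"
    using \<open>\<epsilon> > 0\<close> by (intro order_tendstoD(2)) auto
  then obtain n where n: "integral {a..b} (r n) < \<epsilon> / 2"
    by (auto simp: eventually_sequentially)
  show "\<exists>\<delta>>0. \<forall>D. finite D \<and> (\<forall>(s, t)\<in>D. a \<le> s \<and> s < t \<and> t \<le> b) \<and>
        pairwise (\<lambda>(s, t) (s', t'). disjnt {s<..<t} {s'<..<t'}) D \<and>
        (\<Sum>(s, t)\<in>D. t - s) < \<delta> \<longrightarrow> (\<Sum>(s, t)\<in>D. \<bar>F t - F s\<bar>) < \<epsilon>"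
  proof (intro exI conjI allI impI; (elim conjE)?)
    show "\<epsilon> / (2 * (real n + 1)) > 0" using \<open>\<epsilon> > 0\<close> by simp
    fix D assume "finite D" and D: "\<forall>(s, t)\<in>D. a \<le> s \<and> s < t \<and> t \<le> b"
      and disj: "pairwise (\<lambda>(s, t) (s', t'). disjnt {s<..<t} {s'<..<t'}) D"
      and len: "(\<Sum>(s, t)\<in>D. t - s) < \<epsilon> / (2 * (real n + 1))"
    have int_sub: "q integrable_on {s..t}" if "q absolutely_integrable_on {a..b}" "(s, t) \<in> D"
      for q :: "real \<Rightarrow> real" and s t
      using that D set_lebesgue_integral_eq_integral(1)
      by (metis (no_types, lifting) atLeastatMost_subset_iff case_prodD integrable_on_subinterval)
    have piece: "(\<lambda>x. if x \<in> {fst p<..<snd p} then r n x else 0) integrable_on {a..b}" if "p \<in> D" for p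
    proof -
      have sub: "{fst p<..<snd p} \<subseteq> {a..b}" using D that by force
      have "r n integrable_on {fst p<..<snd p}"
        using int_sub[OF r_int, of "fst p" "snd p"] that integrable_on_open_interval_real by auto
      then show ?thesis
        unfolding integrable_restrict_Int using sub by (simp only: Int_absorb2)
    qed
    have "(\<Sum>(s, t)\<in>D. integral {s..t} (r n)) = (\<Sum>p\<in>D. integral {a..b} (\<lambda>x. if x \<in> {fst p<..<snd p} then r n x else 0))"
    proof (rule sum.cong[OF refl], clarify)
      fix s t assume st: "(s, t) \<in> D"
      have "integral {s..t} (r n) = integral {s<..<t} (r n)"
        using integral_open_interval_real by metis
      also have "\<dots> = integral {a..b} (\<lambda>x. if x \<in> {s<..<t} then r n x else 0)"
        using D st by (subst Henstock_Kurzweil_Integration.integral_restrict_Int) (auto intro!: arg_cong2[where f=integral])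
      finally show "integral {s..t} (r n) = integral {a..b} (\<lambda>x. if x \<in> {fst (s,t)<..<snd (s,t)} then r n x else 0)"
        by simp
    qed
    also have "\<dots> = integral {a..b} (\<lambda>x. \<Sum>p\<in>D. if x \<in> {fst p<..<snd p} then r n x else 0)"
      by (rule Henstock_Kurzweil_Integration.integral_sum[symmetric, OF \<open>finite D\<close> piece])
    also have "\<dots> \<le> integral {a..b} (r n)"
    proof (rule integral_le)
      show "(\<lambda>x. \<Sum>p\<in>D. if x \<in> {fst p<..<snd p} then r n x else 0) integrable_on {a..b}"
        by (rule integrable_sum[OF \<open>finite D\<close> piece])
      show "r n integrable_on {a..b}"
        using r_int set_lebesgue_integral_eq_integral(1) by blast
      fix x
      have "r n x \<ge> 0" by (simp add: r_def)
      show "(\<Sum>p\<in>D. if x \<in> {fst p<..<snd p} then r n x else 0) \<le> r n x"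
      proof (cases "\<exists>p\<in>D. x \<in> {fst p<..<snd p}")
        case True
        then obtain p where p: "p \<in> D" "x \<in> {fst p<..<snd p}" by blast
        have "x \<notin> {fst q<..<snd q}" if "q \<in> D - {p}" for q
          using disj that p unfolding pairwise_def disjnt_def by (force simp: case_prod_beta)
        then have "(\<Sum>q\<in>D - {p}. if x \<in> {fst q<..<snd q} then r n x else 0) = 0"
          by (intro sum.neutral) auto
        then have "(\<Sum>p\<in>D. if x \<in> {fst p<..<snd p} then r n x else 0) = r n x"
          using p \<open>finite D\<close> by (subst sum.remove[of _ p]) auto
        then show ?thesis by simp
      next
        case False
        then have "(\<Sum>p\<in>D. if x \<in> {fst p<..<snd p} then r n x else 0) = 0"
          by (intro sum.neutral) auto
        with \<open>r n x \<ge> 0\<close> show ?thesis by simp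
      qed
    qed
    finally have "(\<Sum>(s, t)\<in>D. integral {s..t} (r n)) < \<epsilon> / 2" using n by simp
    moreover have "(\<Sum>(s, t)\<in>D. \<bar>F t - F s\<bar>) \<le> (\<Sum>(s, t)\<in>D. integral {s..t} (r n) + real n * (t - s))"
    proof (rule sum_mono, clarify)
      fix s t assume st: "(s, t) \<in> D"
      then have s: "a \<le> s" "s < t" "t \<le> b" using D by auto
      have "\<bar>F t - F s\<bar> \<le> integral {s..t} (\<lambda>x. \<bar>h x\<bar>)"
        using F[of s t] s integral_norm_bound_integral[OF int_sub[OF h st] int_sub[OF habs st]] by auto
      also have "\<dots> \<le> integral {s..t} (\<lambda>x. r n x + real n)"
        by (rule integral_le) (use int_sub[OF habs st] int_sub[OF r_int st] in \<open>auto intro!: integrable_add simp: r_def\<close>)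
      also have "\<dots> = integral {s..t} (r n) + real n * (t - s)"
        using s by (subst integral_add) (use int_sub[OF r_int st] in \<open>auto simp: content_real\<close>)
      finally show "\<bar>F t - F s\<bar> \<le> integral {s..t} (r n) + real n * (t - s)" .
    qed
    moreover have "(\<Sum>(s, t)\<in>D. integral {s..t} (r n) + real n * (t - s))
        = (\<Sum>(s, t)\<in>D. integral {s..t} (r n)) + real n * (\<Sum>(s, t)\<in>D. t - s)"
      by (simp add: case_prod_beta sum.distrib sum_distrib_left)
    moreover have "real n * (\<Sum>(s, t)\<in>D. t - s) \<le> \<epsilon> / 2"
    proof -
      have "real n * (\<Sum>(s, t)\<in>D. t - s) \<le> real n * (\<epsilon> / (2 * (real n + 1)))"
        using len by (intro mult_left_mono) auto
      also have "\<dots> \<le> \<epsilon> / 2" using \<open>\<epsilon> > 0\<close> by (simp add: field_simps)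
      finally show ?thesis .
    qed
    ultimately show "(\<Sum>(s, t)\<in>D. \<bar>F t - F s\<bar>) < \<epsilon>" by linarith
  qed
qed


text \<open>The gauge integral permits a direct proof. At a point outside the null set \<open>N\<close> the gauge is a ball
  on which \<open>F\<close> is close to its linearization. At a point of \<open>N\<close> it is an open set \<open>U \<supseteq> N\<close> of
  measure less than \<open>\<delta>\<close>, so that absolute continuity controls the total increment of \<open>F\<close> over the
  intervals tagged in \<open>N\<close>. Redefining the integrand to be \<open>0\<close> on \<open>N\<close> removes those tags from the
  Riemann sum.\<close>

lemma abs_cont_on_fundamental_theorem:
  fixes F \<phi> :: "real \<Rightarrow> real"
  assumes "a \<le> b" and ac: "abs_cont_on a b F" and N: "negligible N"
    and deriv: "\<And>x. x \<in> {a..b} - N \<Longrightarrow> (F has_real_derivative \<phi> x) (at x within {a..b})"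
  shows "(\<phi> has_integral F b - F a) {a..b}"
proof -
  define \<psi> where "\<psi> = (\<lambda>x. if x \<in> N then 0 else \<phi> x)"
  have "(\<psi> has_integral F b - F a) {a..b}"
    unfolding has_integral_real
  proof (intro allI impI)
    fix e :: real assume "e > 0"
    define \<eta> where "\<eta> = e / (2 * (b - a + 1))"
    have "\<eta> > 0" using \<open>e > 0\<close> \<open>a \<le> b\<close> by (simp add: \<eta>_def)
    have \<eta>: "\<eta> * (b - a) \<le> e / 2"
      using \<open>e > 0\<close> \<open>a \<le> b\<close> by (simp add: \<eta>_def field_simps)
    from ac[unfolded abs_cont_on_def, THEN spec, THEN mp, OF half_gt_zero[OF \<open>e > 0\<close>]]
    obtain \<delta> where "\<delta> > 0" and \<delta>: "\<And>D. finite D \<and> (\<forall>(s, t)\<in>D. a \<le> s \<and> s < t \<and> t \<le> b) \<and>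
        pairwise (\<lambda>(s, t) (s', t'). disjnt {s<..<t} {s'<..<t'}) D \<and>
        (\<Sum>(s, t)\<in>D. t - s) < \<delta> \<longrightarrow> (\<Sum>(s, t)\<in>D. \<bar>F t - F s\<bar>) < e / 2"
      by (elim exE conjE) (rule that, assumption, erule spec)
    obtain U where "open U" "N \<subseteq> U" and U: "U \<in> lmeasurable" "measure lebesgue U < \<delta>"
    proof -
      have Nl: "N \<in> lmeasurable" "measure lebesgue N = 0"
        using N by (auto simp: negligible_imp_measurable negligible_imp_measure0)
      obtain U where "open U" "N \<subseteq> U" "U - N \<in> lmeasurable" "emeasure lebesgue (U - N) < ennreal \<delta>"
        using sets_lebesgue_outer_open[OF fmeasurableD[OF Nl(1)] \<open>\<delta> > 0\<close>] by blast
      moreover have U: "U \<in> lmeasurable"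
      proof -
        have "U = (U - N) \<union> N" using \<open>N \<subseteq> U\<close> by blast
        moreover have "(U - N) \<union> N \<in> lmeasurable"
          using \<open>U - N \<in> lmeasurable\<close> Nl(1) by (rule fmeasurable.Un)
        ultimately show ?thesis by simp
      qed
      moreover have "measure lebesgue U = measure lebesgue (U - N)"
        using measurable_measure_Diff[OF U _ \<open>N \<subseteq> U\<close>] Nl by (simp add: fmeasurableD)
      moreover have "measure lebesgue (U - N) < \<delta>"
        using \<open>emeasure lebesgue (U - N) < ennreal \<delta>\<close> \<open>U - N \<in> lmeasurable\<close>
        by (simp add: emeasure_eq_measure2 ennreal_less_iff)
      ultimately show thesis using that by simp
    qed
    have "\<exists>d>0. x \<in> {a..b} - N \<longrightarrow> (\<forall>y\<in>{a..b}. \<bar>y - x\<bar> < d \<longrightarrow>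
            \<bar>F y - F x - \<phi> x * (y - x)\<bar> \<le> \<eta> * \<bar>y - x\<bar>)" for x
    proof (cases "x \<in> {a..b} - N")
      case True
      from deriv[OF this] \<open>\<eta> > 0\<close> show ?thesis
        unfolding has_field_derivative_def has_derivative_within_alt real_norm_def by blast
    qed (use zero_less_one in blast)
    then obtain d where d: "\<And>x. d x > 0"
      and straddle: "\<And>x y. x \<in> {a..b} - N \<Longrightarrow> y \<in> {a..b} \<Longrightarrow> \<bar>y - x\<bar> < d x \<Longrightarrow>
            \<bar>F y - F x - \<phi> x * (y - x)\<bar> \<le> \<eta> * \<bar>y - x\<bar>"
      by metis
    define \<gamma> where "\<gamma> = (\<lambda>x. if x \<in> N then U else ball x (d x))"
    have "gauge \<gamma>"
      using \<open>open U\<close> \<open>N \<subseteq> U\<close> d by (auto simp: gauge_def \<gamma>_def)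
    have small: "norm ((\<Sum>(x, K)\<in>p. measure lborel K *\<^sub>R \<psi> x) - (F b - F a)) < e"
      if p: "p tagged_division_of {a..b}" and fine: "\<gamma> fine p" for p
    proof -
      note pt = tagged_division_ofD[OF p]
      have K: "\<exists>s t. K = {s..t} \<and> s \<le> t \<and> a \<le> s \<and> t \<le> b \<and> s \<le> x \<and> x \<le> t" if xK: "(x, K) \<in> p" for x K
      proof -
        obtain s t where st: "K = {s..t}" using pt(4)[OF xK] by auto
        with pt(2,3)[OF xK] show ?thesis by (intro exI[of _ s] exI[of _ t]) auto
      qed
      define pN where "pN = {(x, K) \<in> p. x \<in> N}"
      define pG where "pG = {(x, K) \<in> p. x \<notin> N}"
      have fin: "finite pN" "finite pG"
        using pt(1) by (auto simp: pN_def pG_def intro: finite_subset[of _ p])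
      have split: "sum q p = sum q pN + sum q pG" for q :: "real \<times> real set \<Rightarrow> real"
        using fin by (subst sum.union_disjoint[symmetric]) (auto simp: pN_def pG_def intro!: arg_cong2[where f=sum])
      have FbFa: "F b - F a = (\<Sum>(x, K)\<in>p. F (Sup K) - F (Inf K))"
        using additive_tagged_division_1[OF \<open>a \<le> b\<close>, of p F] p by simp
      have ba: "b - a = (\<Sum>(x, K)\<in>p. Sup K - Inf K)"
        using additive_tagged_division_1[OF \<open>a \<le> b\<close>, of p "\<lambda>x. x"] p by simp
      have "\<bar>\<Sum>(x, K)\<in>pG. measure lborel K *\<^sub>R \<psi> x - (F (Sup K) - F (Inf K))\<bar>
          \<le> (\<Sum>(x, K)\<in>pG. \<eta> * (Sup K - Inf K))"
        unfolding case_prod_beta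
      proof (rule order_trans[OF sum_abs sum_mono])
        fix xK assume xK: "xK \<in> pG"
        obtain x K where [simp]: "xK = (x, K)" by fastforce
        have x: "(x, K) \<in> p" "x \<notin> N" using xK by (auto simp: pG_def)
        obtain s t where st: "K = {s..t}" "s \<le> t" "a \<le> s" "t \<le> b" "s \<le> x" "x \<le> t"
          using K[OF x(1)] by blast
        have "K \<subseteq> ball x (d x)" using fineD[OF fine x(1)] x(2) by (simp add: \<gamma>_def)
        moreover have "s \<in> K" "t \<in> K" using st by auto
        ultimately have "s \<in> ball x (d x)" "t \<in> ball x (d x)" by blast+
        then have near: "x \<in> {a..b} - N" "s \<in> {a..b}" "t \<in> {a..b}" "\<bar>s - x\<bar> < d x" "\<bar>t - x\<bar> < d x"
          using st x(2) by (auto simp: dist_real_def)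
        have "\<bar>F s - F x - \<phi> x * (s - x)\<bar> \<le> \<eta> * \<bar>s - x\<bar>" "\<bar>F t - F x - \<phi> x * (t - x)\<bar> \<le> \<eta> * \<bar>t - x\<bar>"
          using straddle[OF near(1,2,4)] straddle[OF near(1,3,5)] .
        moreover have "\<eta> * \<bar>s - x\<bar> + \<eta> * \<bar>t - x\<bar> = \<eta> * (t - s)"
          using st by (simp add: algebra_simps)
        moreover have "(t - s) * \<phi> x = \<phi> x * (t - x) - \<phi> x * (s - x)"
          by (simp add: algebra_simps)
        ultimately have "\<bar>(t - s) * \<phi> x - (F t - F s)\<bar> \<le> \<eta> * (t - s)"
          by linarith
        then show "\<bar>measure lborel (snd xK) *\<^sub>R \<psi> (fst xK) - (F (Sup (snd xK)) - F (Inf (snd xK)))\<bar>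
            \<le> \<eta> * (Sup (snd xK) - Inf (snd xK))"
          using st x by (simp add: \<psi>_def)
      qed
      also have "\<dots> \<le> (\<Sum>(x, K)\<in>p. \<eta> * (Sup K - Inf K))"
      proof (rule sum_mono2[OF pt(1)])
        show "pG \<subseteq> p" by (auto simp: pG_def)
        fix xK assume xK: "xK \<in> p - pG"
        obtain x K where [simp]: "xK = (x, K)" by fastforce
        obtain s t where "K = {s..t}" "s \<le> t" using K[of x K] xK by auto
        then show "0 \<le> (case xK of (x, K) \<Rightarrow> \<eta> * (Sup K - Inf K))"
          using \<open>\<eta> > 0\<close> by simp
      qed
      also have "\<dots> = \<eta> * (b - a)"
        unfolding ba sum_distrib_left by (simp add: case_prod_beta)
      also note \<eta>
      finally have good: "\<bar>\<Sum>(x, K)\<in>pG. measure lborel K *\<^sub>R \<psi> x - (F (Sup K) - F (Inf K))\<bar> \<le> e / 2" .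
      have bad: "(\<Sum>(x, K)\<in>pN. \<bar>F (Sup K) - F (Inf K)\<bar>) < e / 2"
      proof -
        have ptN: "pN tagged_partial_division_of {a..b}"
          using p tagged_partial_division_subset[of p "{a..b}" pN]
          by (auto simp: tagged_division_of_def pN_def)
        define \<D> where "\<D> = snd ` pN"
        have div: "\<D> division_of \<Union>\<D>"
          unfolding \<D>_def by (rule partial_division_of_tagged_division[OF ptN])
        have \<D>: "\<exists>s t. K = {s..t} \<and> s \<le> t \<and> a \<le> s \<and> t \<le> b" "K \<subseteq> U" if "K \<in> \<D>" for K
        proof -
          obtain x where x: "(x, K) \<in> p" "x \<in> N" using \<open>K \<in> \<D>\<close> by (auto simp: \<D>_def pN_def)
          show "\<exists>s t. K = {s..t} \<and> s \<le> t \<and> a \<le> s \<and> t \<le> b" using K[OF x(1)] by blast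
          show "K \<subseteq> U" using fineD[OF fine x(1)] x(2) by (simp add: \<gamma>_def)
        qed
        \<comment> \<open>Absolute continuity speaks of nondegenerate intervals only; on the degenerate ones \<open>F\<close> has
          no increment.\<close>
        define \<E> where "\<E> = {K \<in> \<D>. interior K \<noteq> {}}"
        define D where "D = (\<lambda>K. (Inf K, Sup K)) ` \<E>"
        have finD: "finite \<D>" "finite \<E>" using fin by (auto simp: \<D>_def \<E>_def)
        have \<E>: "K = {Inf K..Sup K} \<and> Inf K < Sup K \<and> a \<le> Inf K \<and> Sup K \<le> b" if K: "K \<in> \<E>" for K
        proof -
          obtain s t where "K = {s..t}" "s \<le> t" "a \<le> s" "t \<le> b" using \<D>(1)[of K] K unfolding \<E>_def by blast
          moreover have "s < t" using K calculation by (auto simp: \<E>_def)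
          ultimately show ?thesis by simp
        qed
        have inj: "inj_on (\<lambda>K. (Inf K, Sup K)) \<E>"
          by (rule inj_onI) (metis \<E> prod.inject)
        have "(\<Sum>(s, t)\<in>D. \<bar>F t - F s\<bar>) < e / 2"
        proof (rule \<delta>[THEN mp], intro conjI)
          show "finite D" using finD by (simp add: D_def)
          show "\<forall>(s, t)\<in>D. a \<le> s \<and> s < t \<and> t \<le> b" using \<E> by (auto simp: D_def)
          show "pairwise (\<lambda>(s, t) (s', t'). disjnt {s<..<t} {s'<..<t'}) D"
            unfolding pairwise_def D_def
          proof (clarsimp simp del: Inf_atLeastAtMost)
            fix K L assume KL: "K \<in> \<E>" "L \<in> \<E>" "Inf K = Inf L \<longrightarrow> Sup K \<noteq> Sup L"
            then have "interior K \<inter> interior L = {}"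
              using division_ofD(5)[OF div, of K L] by (auto simp: \<E>_def)
            moreover have "interior K = {Inf K<..<Sup K}" "interior L = {Inf L<..<Sup L}"
              using \<E>[OF KL(1)] \<E>[OF KL(2)] by (metis interior_atLeastAtMost_real)+
            ultimately show "disjnt {Inf K<..<Sup K} {Inf L<..<Sup L}"
              by (simp add: disjnt_def)
          qed
          have "(\<Sum>(s, t)\<in>D. t - s) = (\<Sum>K\<in>\<E>. Sup K - Inf K)"
            unfolding D_def by (subst sum.reindex[OF inj]) simp
          also have "\<dots> = (\<Sum>K\<in>\<E>. measure lborel K)"
            by (rule sum.cong[OF refl]) (metis \<E> content_real less_imp_le)
          also have "\<dots> \<le> (\<Sum>K\<in>\<D>. measure lborel K)"
            by (rule sum_mono2[OF finD(1)]) (auto simp: \<E>_def)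
          also have "\<dots> = (\<Sum>K\<in>\<D>. measure lebesgue K)"
          proof (rule sum.cong[OF refl])
            fix K assume "K \<in> \<D>"
            then obtain s t where "K = {s..t}" using \<D>(1)[of K] by blast
            then show "measure lborel K = measure lebesgue K" by simp
          qed
          also have "\<dots> = measure lebesgue (\<Union>\<D>)"
            by (rule content_division[OF div])
          also have "\<dots> \<le> measure lebesgue U"
            using \<D>(2) U(1) lmeasurable_division[OF div] by (intro measure_mono_fmeasurable) auto
          finally show "(\<Sum>(s, t)\<in>D. t - s) < \<delta>" using U(2) by simp
        qed
        moreover have "(\<Sum>(s, t)\<in>D. \<bar>F t - F s\<bar>) = (\<Sum>K\<in>\<E>. \<bar>F (Sup K) - F (Inf K)\<bar>)"
          unfolding D_def by (subst sum.reindex[OF inj]) simp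
        moreover have "\<dots> = (\<Sum>K\<in>\<D>. \<bar>F (Sup K) - F (Inf K)\<bar>)"
        proof (rule sum.mono_neutral_left[OF finD(1)])
          show "\<E> \<subseteq> \<D>" by (auto simp: \<E>_def)
          show "\<forall>K\<in>\<D> - \<E>. \<bar>F (Sup K) - F (Inf K)\<bar> = 0"
          proof
            fix K assume K: "K \<in> \<D> - \<E>"
            then obtain s t where "K = {s..t}" "s \<le> t" using \<D>(1)[of K] by blast
            moreover have "\<not> s < t" using K calculation by (auto simp: \<E>_def)
            ultimately show "\<bar>F (Sup K) - F (Inf K)\<bar> = 0" by simp
          qed
        qed
        moreover have "(\<Sum>(x, K)\<in>pN. \<bar>F (Sup K) - F (Inf K)\<bar>) = (\<Sum>K\<in>\<D>. \<bar>F (Sup K) - F (Inf K)\<bar>)"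
        proof -
          define q where "q = (\<lambda>K. if K = {} then 0 else \<bar>F (Sup K) - F (Inf K)\<bar>)"
          have q: "q K = \<bar>F (Sup K) - F (Inf K)\<bar>" if "K \<in> \<D>" for K
            using \<D>(1)[OF that] by (auto simp: q_def)
          have "q (cbox u v) = 0" if "box u v = {}" for u v
            using that by (cases "u = v") (auto simp: q_def)
          then have "(\<Sum>(_, K)\<in>pN. q K) = sum q \<D>"
            unfolding \<D>_def
            by (rule sum.over_tagged_division_lemma[OF tagged_partial_division_of_Union_self[OF ptN]])
          moreover have "(\<Sum>(_, K)\<in>pN. q K) = (\<Sum>(x, K)\<in>pN. \<bar>F (Sup K) - F (Inf K)\<bar>)"
          proof (rule sum.cong[OF refl], clarify)
            fix x K assume "(x, K) \<in> pN"
            then have "K \<in> \<D>" unfolding \<D>_def by force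
            then show "q K = \<bar>F (Sup K) - F (Inf K)\<bar>" by (rule q)
          qed
          ultimately show ?thesis using q by simp
        qed
        ultimately show ?thesis by simp
      qed
      have "(\<Sum>(x, K)\<in>p. measure lborel K *\<^sub>R \<psi> x) - (F b - F a)
          = (\<Sum>(x, K)\<in>p. measure lborel K *\<^sub>R \<psi> x - (F (Sup K) - F (Inf K)))"
        unfolding FbFa by (simp add: case_prod_beta sum_subtractf)
      also have "\<dots> = (\<Sum>(x, K)\<in>pN. measure lborel K *\<^sub>R \<psi> x - (F (Sup K) - F (Inf K)))
          + (\<Sum>(x, K)\<in>pG. measure lborel K *\<^sub>R \<psi> x - (F (Sup K) - F (Inf K)))"
        by (rule split)
      also have "(\<Sum>(x, K)\<in>pN. measure lborel K *\<^sub>R \<psi> x - (F (Sup K) - F (Inf K)))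
          = (\<Sum>(x, K)\<in>pN. - (F (Sup K) - F (Inf K)))"
        by (rule sum.cong) (auto simp: pN_def \<psi>_def)
      finally have "\<bar>(\<Sum>(x, K)\<in>p. measure lborel K *\<^sub>R \<psi> x) - (F b - F a)\<bar>
          \<le> \<bar>\<Sum>(x, K)\<in>pN. - (F (Sup K) - F (Inf K))\<bar> + e / 2"
        using good by linarith
      also have "\<bar>\<Sum>(x, K)\<in>pN. - (F (Sup K) - F (Inf K))\<bar> \<le> (\<Sum>(x, K)\<in>pN. \<bar>F (Sup K) - F (Inf K)\<bar>)"
        unfolding case_prod_beta by (rule order_trans[OF sum_abs]) (simp add: abs_minus_commute)
      finally show ?thesis using bad by simp
    qed
    show "\<exists>\<gamma>. gauge \<gamma> \<and> (\<forall>p. p tagged_division_of {a..b} \<and> \<gamma> fine p \<longrightarrow>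
        norm ((\<Sum>(x, K)\<in>p. measure lborel K *\<^sub>R \<psi> x) - (F b - F a)) < e)" 
      by (rule exI[of _ \<gamma>], rule conjI[OF \<open>gauge \<gamma>\<close>], intro allI impI, elim conjE, rule small)
  qed
  then show ?thesis
    by (rule has_integral_spike[OF N, rotated]) (simp add: \<psi>_def)
qed

lemma abs_cont_on_subinterval:
  assumes ac: "abs_cont_on a b F" and st: "a \<le> s" "t \<le> b"
  shows "abs_cont_on s t F"
  unfolding abs_cont_on_def
proof (intro allI impI)
  fix \<epsilon> :: real assume "\<epsilon> > 0"
  from ac[unfolded abs_cont_on_def, THEN spec, THEN mp, OF this]
  obtain \<delta> where "\<delta> > 0" and \<delta>: "\<And>D. finite D \<and> (\<forall>(p, q)\<in>D. a \<le> p \<and> p < q \<and> q \<le> b) \<and>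
      pairwise (\<lambda>(p, q) (p', q'). disjnt {p<..<q} {p'<..<q'}) D \<and>
      (\<Sum>(p, q)\<in>D. q - p) < \<delta> \<longrightarrow> (\<Sum>(p, q)\<in>D. \<bar>F q - F p\<bar>) < \<epsilon>"
    by (elim exE conjE) (rule that, assumption, erule spec)
  show "\<exists>\<delta>>0. \<forall>D. finite D \<and> (\<forall>(p, q)\<in>D. s \<le> p \<and> p < q \<and> q \<le> t) \<and>
      pairwise (\<lambda>(p, q) (p', q'). disjnt {p<..<q} {p'<..<q'}) D \<and>
      (\<Sum>(p, q)\<in>D. q - p) < \<delta> \<longrightarrow> (\<Sum>(p, q)\<in>D. \<bar>F q - F p\<bar>) < \<epsilon>"
  proof (rule exI[of _ \<delta>], rule conjI[OF \<open>\<delta> > 0\<close>], intro allI impI, elim conjE)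
    fix D assume D: "finite D" "\<forall>(p, q)\<in>D. s \<le> p \<and> p < q \<and> q \<le> t"
      "pairwise (\<lambda>(p, q) (p', q'). disjnt {p<..<q} {p'<..<q'}) D" "(\<Sum>(p, q)\<in>D. q - p) < \<delta>"
    have "\<forall>(p, q)\<in>D. a \<le> p \<and> p < q \<and> q \<le> b"
      using D(2) st by fastforce
    with D show "(\<Sum>(p, q)\<in>D. \<bar>F q - F p\<bar>) < \<epsilon>"
      by (intro \<delta>[THEN mp] conjI)
  qed
qed

section \<open>Zeros, signs and the Sturm comparison inequality\<close>

text \<open>This is Sturm's comparison for \<open>u'' + q u = 0\<close> and \<open>\<phi>'' + w\<^sup>2 \<phi> = 0\<close>, where the
  derivative of the Wronskian is \<open>- (w\<^sup>2 - q) u \<phi>\<close>. Here \<open>q u \<le> \<kappa> u\<close> is known only in the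
  integrated form that \<open>v + \<kappa> \<integral> u\<close> is nondecreasing, and \<open>v\<close> need not be differentiable. The second
  mean value theorem replaces the integration by parts of this monotone function against \<open>\<phi>'\<close>.\<close>

lemma sturm_wronskian_le:
  fixes u v \<phi> \<psi> :: "real \<Rightarrow> real"
  assumes "s \<le> t"
    and u: "\<And>x. x \<in> {s..t} \<Longrightarrow> (u has_real_derivative v x) (at x within {s..t})"
    and v: "continuous_on {s..t} v"
    and upper: "\<And>x y. s \<le> x \<Longrightarrow> x \<le> y \<Longrightarrow> y \<le> t \<Longrightarrow> v x - v y \<le> \<kappa> * integral {x..y} u"
    and \<phi>: "\<And>x. (\<phi> has_real_derivative \<psi> x) (at x)"
    and \<psi>: "\<And>x. (\<psi> has_real_derivative - (w\<^sup>2) * \<phi> x) (at x)"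
    and pos: "\<And>x. x \<in> {s..t} \<Longrightarrow> 0 \<le> \<phi> x"
  shows "(u t * \<psi> t - v t * \<phi> t) - (u s * \<psi> s - v s * \<phi> s)
           \<le> - (w\<^sup>2 - \<kappa>) * integral {s..t} (\<lambda>x. u x * \<phi> x)"
proof -
  have cu: "continuous_on {s..t} u"
    using u by (meson DERIV_continuous continuous_on_eq_continuous_within)
  have c\<phi>: "continuous_on S \<phi>" and c\<psi>: "continuous_on S \<psi>" for S
    using \<phi> \<psi> by (meson DERIV_isCont continuous_at_imp_continuous_on)+
  define U where "U = (\<lambda>x. integral {s..x} u)"
  have U: "(U has_real_derivative u x) (at x within {s..t})" if "x \<in> {s..t}" for x
    unfolding U_def by (rule integral_has_real_derivative[OF cu that])
  define G where "G = (\<lambda>x. v x + \<kappa> * U x)"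
  have G_mono: "G x \<le> G y" if "s \<le> x" "x \<le> y" "y \<le> t" for x y
  proof -
    have "U x + integral {x..y} u = U y"
      unfolding U_def by (intro Henstock_Kurzweil_Integration.integral_combine that(1,2)
          integrable_continuous_real continuous_on_subset[OF cu]) (use that in auto)
    then have "\<kappa> * U y = \<kappa> * U x + \<kappa> * integral {x..y} u" by (simp flip: distrib_left)
    with upper[OF that] show ?thesis by (simp add: G_def)
  qed
  have int_\<psi>: "integral {x..y} \<psi> = \<phi> y - \<phi> x" if "x \<le> y" for x y
    by (intro integral_unique fundamental_theorem_of_calculus that)
      (use \<phi> in \<open>auto simp flip: has_real_derivative_iff_has_vector_derivative intro: has_field_derivative_at_within\<close>)
  obtain c where c: "c \<in> {s..t}"
    and smvt: "integral {s..t} (\<lambda>x. G x * \<psi> x) = G s * integral {s..c} \<psi> + G t * integral {c..t} \<psi>"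
    by (rule second_mean_value_theorem[OF integrable_continuous_real[OF c\<psi>] \<open>s \<le> t\<close>, of G])
      (auto intro: G_mono that)
  have "(G t - G s) * \<phi> c \<ge> 0"
    using G_mono[of s t] pos[OF c] \<open>s \<le> t\<close> by simp
  with smvt c have le: "integral {s..t} (\<lambda>x. G x * \<psi> x) \<le> G t * \<phi> t - G s * \<phi> s"
    by (simp add: int_\<psi> algebra_simps)
  have cU: "continuous_on {s..t} U"
    using U by (meson DERIV_continuous continuous_on_eq_continuous_within)
  have int1: "(\<lambda>x. G x * \<psi> x) integrable_on {s..t}" and int2: "(\<lambda>x. u x * \<phi> x) integrable_on {s..t}"
    unfolding G_def by (intro integrable_continuous_real continuous_intros v cU c\<phi> c\<psi> cu)+
  \<comment> \<open>The derivative of \<open>M\<close> is \<open>G * \<psi>\<close> up to the term that measures the gap between the two equations.\<close>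
  define M where "M = (\<lambda>x. u x * \<psi> x + \<kappa> * (U x * \<phi> x))"
  have "((\<lambda>x. G x * \<psi> x - (w\<^sup>2 - \<kappa>) * (u x * \<phi> x)) has_integral M t - M s) {s..t}"
  proof (rule fundamental_theorem_of_calculus[OF \<open>s \<le> t\<close>])
    fix x assume x: "x \<in> {s..t}"
    have "(M has_real_derivative G x * \<psi> x - (w\<^sup>2 - \<kappa>) * (u x * \<phi> x)) (at x within {s..t})"
      unfolding M_def G_def
      by (rule derivative_eq_intros u[OF x] U[OF x] has_field_derivative_at_within[OF \<phi>]
          has_field_derivative_at_within[OF \<psi>] refl)+ (simp add: algebra_simps)
    then show "(M has_vector_derivative G x * \<psi> x - (w\<^sup>2 - \<kappa>) * (u x * \<phi> x)) (at x within {s..t})"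
      by (simp add: has_real_derivative_iff_has_vector_derivative)
  qed
  then have "M t - M s = integral {s..t} (\<lambda>x. G x * \<psi> x - (w\<^sup>2 - \<kappa>) * (u x * \<phi> x))"
    by (simp add: has_integral_iff)
  also have "\<dots> = integral {s..t} (\<lambda>x. G x * \<psi> x) - (w\<^sup>2 - \<kappa>) * integral {s..t} (\<lambda>x. u x * \<phi> x)"
    by (subst Henstock_Kurzweil_Integration.integral_diff)
      (use int1 int2 in \<open>auto intro: integrable_on_mult_right\<close>)
  finally have "M t - M s + (w\<^sup>2 - \<kappa>) * integral {s..t} (\<lambda>x. u x * \<phi> x) \<le> G t * \<phi> t - G s * \<phi> s"
    using le by simp
  moreover have "U s = 0" by (simp add: U_def)
  ultimately show ?thesis
    by (simp add: M_def G_def algebra_simps)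
qed

lemma last_zero_before:
  fixes u :: "real \<Rightarrow> real"
  assumes u: "continuous_on {z..p} u" and "z < p" "u z = 0" "0 < u p"
  obtains l where "z \<le> l" "l < p" "u l = 0" "\<And>x. l < x \<Longrightarrow> x \<le> p \<Longrightarrow> 0 < u x"
proof -
  define S where "S = {x \<in> {z..p}. u x = 0}"
  have "closed S"
    unfolding S_def using continuous_closed_preimage_constant[OF u, of 0] by simp
  then have "compact S"
    by (rule compact_eq_bounded_closed[THEN iffD2, OF conjI, rotated]) (auto simp: S_def intro: bounded_subset[of "{z..p}"])
  moreover have "z \<in> S" using assms by (auto simp: S_def)
  ultimately obtain l where l: "l \<in> S" "\<And>x. x \<in> S \<Longrightarrow> x \<le> l"
    using compact_attains_sup[of S] by blast
  have "0 < u x" if x: "l < x" "x \<le> p" for x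
  proof (rule ccontr)
    assume "\<not> 0 < u x"
    then obtain y where "x \<le> y" "y \<le> p" "u y = 0"
      using IVT'[of u x 0 p] x l(1) \<open>0 < u p\<close> continuous_on_subset[OF u, of "{x..p}"]
      by (force simp: S_def)
    then have "y \<in> S" using x l(1) by (auto simp: S_def)
    with l(2)[of y] x \<open>x \<le> y\<close> show False by simp
  qed
  moreover have "l \<noteq> p" using l(1) \<open>0 < u p\<close> by (auto simp: S_def)
  ultimately show thesis using l(1) that[of l] by (auto simp: S_def)
qed

lemma first_zero_after:
  fixes u :: "real \<Rightarrow> real"
  assumes u: "continuous_on {p..z} u" and "p < z" "u z = 0" "0 < u p"
  obtains r where "p < r" "r \<le> z" "u r = 0" "\<And>x. p \<le> x \<Longrightarrow> x < r \<Longrightarrow> 0 < u x"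
proof -
  have "continuous_on {-z..-p} (\<lambda>x. u (- x))"
    by (rule continuous_on_compose2[OF u]) (auto intro!: continuous_intros)
  from last_zero_before[OF this] assms obtain l where
    "- z \<le> l" "l < - p" "u (- l) = 0" and l: "\<And>x. l < x \<Longrightarrow> x \<le> - p \<Longrightarrow> 0 < u (- x)"
    by auto
  moreover have "0 < u x" if "p \<le> x" "x < - l" for x
    using l[of "- x"] that by simp
  ultimately show thesis by (intro that[of "- l"]) auto
qed

lemma DERIV_le_0_at_right_zero:
  fixes u :: "real \<Rightarrow> real"
  assumes "(u has_real_derivative D) (at r within {a..b})" "a \<le> l" "l < r" "r \<le> b"
    and "u r = 0" "\<And>x. l < x \<Longrightarrow> x < r \<Longrightarrow> 0 \<le> u x"
  shows "D \<le> 0"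
proof (rule ccontr)
  assume "\<not> D \<le> 0"
  then obtain d where "d > 0" and d: "\<And>h. 0 < h \<Longrightarrow> r - h \<in> {a..b} \<Longrightarrow> h < d \<Longrightarrow> u (r - h) < u r"
    using has_real_derivative_pos_inc_left[OF assms(1)] by force
  define h where "h = min (d / 2) ((r - l) / 2)"
  have "0 < h" "h < d" "h < r - l"
    using \<open>d > 0\<close> \<open>l < r\<close> by (auto simp: h_def min_def field_simps)
  then show False
    using d[of h] assms(2-6) by (smt (verit) atLeastAtMost_iff)
qed

lemma continuous_nonzero_same_sign:
  fixes u :: "real \<Rightarrow> real"
  assumes "continuous_on {p..q} u" "p \<le> q" "\<And>x. x \<in> {p..q} \<Longrightarrow> u x \<noteq> 0"
  shows "0 < u p \<longleftrightarrow> 0 < u q"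
proof (rule ccontr)
  assume "\<not> ?thesis"
  moreover have "u p \<noteq> 0" "u q \<noteq> 0" using assms by auto
  ultimately consider "0 \<le> u p" "u q \<le> 0" | "u p \<le> 0" "0 \<le> u q" by linarith
  then obtain x where "x \<in> {p..q}" "u x = 0"
  proof cases
    case 1
    from IVT2'[of u q 0 p] 1 assms(1,2) that show thesis by auto
  next
    case 2
    from IVT'[of u p 0 q] 2 assms(1,2) that show thesis by auto
  qed
  with assms(3) show False by blast
qed

lemma sinusoid_interpolation:
  fixes A E :: real
  shows "sin (\<gamma> - \<alpha>) * (A * cos \<beta> + E * sin \<beta>)
    = sin (\<gamma> - \<beta>) * (A * cos \<alpha> + E * sin \<alpha>) + sin (\<beta> - \<alpha>) * (A * cos \<gamma> + E * sin \<gamma>)"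
  by (simp add: sin_diff algebra_simps)

text \<open>On an interval shorter than half a turn, a solution of \<open>\<phi>'' + w\<^sup>2 \<phi> = 0\<close> is a combination of its
  values at the two ends with nonnegative coefficients.\<close>

lemma sinusoid_nonneg_between:
  fixes A E w c :: real
  defines "\<phi> \<equiv> \<lambda>x. A * cos (w * (x - c)) + E * sin (w * (x - c))"
  assumes w: "0 < w" "w * (q - p) < pi" and pq: "p < q" "p \<le> x" "x \<le> q"
    and ends: "0 \<le> \<phi> p" "0 \<le> \<phi> q"
  shows "0 \<le> \<phi> x"
proof -
  have "sin (w * (q - p)) * \<phi> x = sin (w * (q - x)) * \<phi> p + sin (w * (x - p)) * \<phi> q"
    using sinusoid_interpolation[of "w * (q - c)" "w * (p - c)" A "w * (x - c)" E]
    by (simp add: \<phi>_def algebra_simps)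
  moreover have "w * (q - x) \<le> w * (q - p)" "w * (x - p) \<le> w * (q - p)"
    using w(1) pq by (auto intro: mult_left_mono)
  then have "w * (q - x) \<le> pi" "w * (x - p) \<le> pi" using w(2) by linarith+
  then have "0 \<le> sin (w * (q - x))" "0 \<le> sin (w * (x - p))"
    using w pq by (auto intro!: sin_ge_zero)
  ultimately have "0 \<le> sin (w * (q - p)) * \<phi> x" using ends by simp
  moreover have "0 < sin (w * (q - p))" using w pq by (intro sin_gt_zero) auto
  ultimately show ?thesis by (simp add: zero_le_mult_iff)
qed

section \<open>Two-sided linear differential inequalities\<close>

text \<open>Below, \<open>k1\<close> and \<open>k2\<close> are bounds for the slopes of the nonlinearity on the two sides of \<open>x0\<close>, and \<open>a\<close>
  is a lower bound for them. The two smallness conditions say that on \<open>[0, x0]\<close> and on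
  \<open>[x0, \<pi>]\<close> a solution of \<open>u'' + k u = 0\<close> turns by less than \<open>\<pi>\<close>.\<close>

locale two_step_bound =
  fixes a :: "real \<Rightarrow> real" and x0 k1 k2 :: real
  assumes x0: "0 < x0" "x0 < pi"
    and a_measurable: "a \<in> borel_measurable lebesgue"
    and a_nonneg: "\<And>x. 0 \<le> a x"
    and a_le_left: "\<And>x. x < x0 \<Longrightarrow> a x \<le> k1"
    and a_le_right: "\<And>x. x0 \<le> x \<Longrightarrow> a x \<le> k2"
    and a_not_null: "\<not> negligible {x \<in> {0..pi}. 0 < a x}"
    and left_small: "k1 * x0\<^sup>2 < pi\<^sup>2"
    and right_small: "k2 * (pi - x0)\<^sup>2 < pi\<^sup>2"
begin

definition k :: "real \<Rightarrow> real" where "k x = (if x < x0 then k1 else k2)"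

text \<open>A common bound for \<open>a\<close> and \<open>k\<close>; the summand \<open>1\<close> makes it positive.\<close>

definition B :: real where "B = k1 + k2 + 1"

lemma k_nonneg: "0 \<le> k1" "0 \<le> k2"
  using a_nonneg a_le_left[of "x0 - 1"] a_le_right[of x0] by (meson less_add_one diff_less_eq order_refl order_trans)+

lemma a_le_k: "a x \<le> k x"
  using a_le_left a_le_right by (simp add: k_def)

lemma k_bounds: "0 \<le> k x" "k x \<le> B" "\<bar>k x\<bar> \<le> B" "\<bar>a x\<bar> \<le> B"
  using k_nonneg a_le_k[of x] a_nonneg[of x] by (auto simp: k_def B_def split: if_splits)

lemma B_pos: "1 \<le> B" using k_nonneg by (simp add: B_def)

lemma k_measurable: "k \<in> borel_measurable lebesgue"
  unfolding k_def by (rule measurable_completion) measurable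

text \<open>\<open>lower u x\<close> and \<open>upper u x\<close> are the smallest and the largest value of
  \<open>q * u x\<close> for \<open>q\<close> in the interval from \<open>a x\<close> to \<open>k x\<close>.\<close>

definition lower :: "(real \<Rightarrow> real) \<Rightarrow> real \<Rightarrow> real" where
  "lower u x = a x * max 0 (u x) - k x * max 0 (- u x)"

definition upper :: "(real \<Rightarrow> real) \<Rightarrow> real \<Rightarrow> real" where
  "upper u x = k x * max 0 (u x) - a x * max 0 (- u x)"

text \<open>The pair \<open>(u, u')\<close> solves \<open>u'' + q u = 0\<close> for some coefficient \<open>a \<le> q \<le> k\<close>, expressed without
  \<open>q\<close> by bounds on the increments of \<open>u'\<close>. In contrast to the equation, these bounds pass
  directly to uniform limits.\<close>

definition admissible :: "(real \<Rightarrow> real) \<Rightarrow> (real \<Rightarrow> real) \<Rightarrow> bool" where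
  "admissible u v \<longleftrightarrow>
     (\<forall>x\<in>{0..pi}. (u has_real_derivative v x) (at x within {0..pi})) \<and>
     continuous_on {0..pi} v \<and>
     (\<forall>s t. 0 \<le> s \<longrightarrow> s \<le> t \<longrightarrow> t \<le> pi \<longrightarrow>
        integral {s..t} (lower u) \<le> v s - v t \<and> v s - v t \<le> integral {s..t} (upper u))"

lemma admissibleD:
  assumes "admissible u v"
  shows "\<And>x. x \<in> {0..pi} \<Longrightarrow> (u has_real_derivative v x) (at x within {0..pi})"
    and "continuous_on {0..pi} u" and "continuous_on {0..pi} v"
    and "\<And>s t. 0 \<le> s \<Longrightarrow> s \<le> t \<Longrightarrow> t \<le> pi \<Longrightarrow> integral {s..t} (lower u) \<le> v s - v t"
    and "\<And>s t. 0 \<le> s \<Longrightarrow> s \<le> t \<Longrightarrow> t \<le> pi \<Longrightarrow> v s - v t \<le> integral {s..t} (upper u)"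
  using assms unfolding admissible_def
  by (auto intro: DERIV_continuous_on)

lemma bounds_integrable:
  assumes "continuous_on {s..t} u"
  shows "lower u integrable_on {s..t}" "upper u integrable_on {s..t}"
proof -
  have 1: "continuous_on {s..t} (\<lambda>x. max 0 (u x))" "continuous_on {s..t} (\<lambda>x. max 0 (- u x))"
    by (intro continuous_intros assms)+
  note ai = continuous_mult_bounded_absolutely_integrable[THEN set_lebesgue_integral_eq_integral(1)]
  show "lower u integrable_on {s..t}" "upper u integrable_on {s..t}"
    unfolding lower_def upper_def
    by (intro integrable_diff ai[OF k_measurable k_bounds(3)] ai[OF a_measurable k_bounds(4)] 1)+
qed

lemma admissible_minus:
  assumes uv: "admissible u v"
  shows "admissible (\<lambda>x. - u x) (\<lambda>x. - v x)"
proof -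
  have [simp]: "lower (\<lambda>x. - u x) = (\<lambda>x. - upper u x)" "upper (\<lambda>x. - u x) = (\<lambda>x. - lower u x)"
    by (auto simp: lower_def upper_def)
  show ?thesis
    using admissibleD[OF uv] unfolding admissible_def
    by (auto intro!: derivative_eq_intros continuous_intros simp: le_diff_eq algebra_simps)
qed

lemma admissible_scale:
  assumes uv: "admissible u v" and "0 \<le> c"
  shows "admissible (\<lambda>x. c * u x) (\<lambda>x. c * v x)"
proof -
  have max: "max 0 (c * y) = c * max 0 y" for y using \<open>0 \<le> c\<close> by (simp add: max_mult_distrib_left)
  have [simp]: "lower (\<lambda>x. c * u x) = (\<lambda>x. c * lower u x)" "upper (\<lambda>x. c * u x) = (\<lambda>x. c * upper u x)"
    using max max[of "- u _"] by (auto simp: lower_def upper_def fun_eq_iff right_diff_distrib)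
  show ?thesis
    using admissibleD[OF uv] mult_left_mono[OF _ \<open>0 \<le> c\<close>] unfolding admissible_def
    by (auto intro!: derivative_eq_intros continuous_intros simp flip: right_diff_distrib)
qed

lemma admissible_lipschitz:
  assumes uv: "admissible u v" and st: "0 \<le> s" "s \<le> t" "t \<le> pi"
  shows "\<bar>v t - v s\<bar> \<le> B * integral {s..t} (\<lambda>x. \<bar>u x\<bar>)"
proof -
  have cu: "continuous_on {s..t} u"
    using st by (auto intro: continuous_on_subset[OF admissibleD(2)[OF uv]])
  have bound: "\<bar>lower u x\<bar> \<le> B * \<bar>u x\<bar>" "\<bar>upper u x\<bar> \<le> B * \<bar>u x\<bar>" for x
    using k_bounds[of x] a_nonneg[of x]
    by (cases "u x \<ge> 0"; simp add: lower_def upper_def abs_mult mult_right_mono)+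
  have "\<bar>integral {s..t} (lower u)\<bar> \<le> integral {s..t} (\<lambda>x. B * \<bar>u x\<bar>)"
       "\<bar>integral {s..t} (upper u)\<bar> \<le> integral {s..t} (\<lambda>x. B * \<bar>u x\<bar>)"
    using bound unfolding real_norm_def[symmetric]
    by (intro integral_norm_bound_integral bounds_integrable cu integrable_continuous_real continuous_intros; simp)+
  with admissibleD(4,5)[OF uv st] show ?thesis by simp
qed

lemma admissible_growth:
  assumes uv: "admissible u v" and st: "0 \<le> s" "s \<le> t" "t \<le> pi"
  shows "\<bar>(\<bar>u t\<bar> + \<bar>v t\<bar>) - (\<bar>u s\<bar> + \<bar>v s\<bar>)\<bar> \<le> (B + 1) * integral {s..t} (\<lambda>x. \<bar>u x\<bar> + \<bar>v x\<bar>)"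
proof -
  have cu: "continuous_on {s..t} u" and cv: "continuous_on {s..t} v"
    using st by (auto intro: continuous_on_subset[OF admissibleD(2)[OF uv]] continuous_on_subset[OF admissibleD(3)[OF uv]])
  have int: "(\<lambda>x. \<bar>u x\<bar>) integrable_on {s..t}" "(\<lambda>x. \<bar>v x\<bar>) integrable_on {s..t}" "v integrable_on {s..t}"
    by (intro integrable_continuous_real continuous_intros cu cv)+
  have "(v has_integral (u t - u s)) {s..t}"
    using st by (intro fundamental_theorem_of_calculus)
      (auto simp flip: has_real_derivative_iff_has_vector_derivative intro: DERIV_subset[OF admissibleD(1)[OF uv]])
  then have "u t - u s = integral {s..t} v" by (simp add: has_integral_iff)
  then have step: "\<bar>u t - u s\<bar> \<le> integral {s..t} (\<lambda>x. \<bar>v x\<bar>)"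
    using integral_norm_bound_integral[OF int(3,2)] by simp
  define X Y where "X = integral {s..t} (\<lambda>x. \<bar>u x\<bar>)" and "Y = integral {s..t} (\<lambda>x. \<bar>v x\<bar>)"
  have "\<bar>(\<bar>u t\<bar> + \<bar>v t\<bar>) - (\<bar>u s\<bar> + \<bar>v s\<bar>)\<bar> = \<bar>(\<bar>u t\<bar> - \<bar>u s\<bar>) + (\<bar>v t\<bar> - \<bar>v s\<bar>)\<bar>"
    by (simp add: algebra_simps)
  also have "\<dots> \<le> \<bar>u t - u s\<bar> + \<bar>v t - v s\<bar>"
    by (rule order_trans[OF abs_triangle_ineq add_mono]) (rule abs_triangle_ineq3)+
  also have "\<dots> \<le> Y + B * X"
    using step admissible_lipschitz[OF uv st] by (simp add: X_def Y_def)
  also have "\<dots> \<le> (B + 1) * (X + Y)"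
  proof -
    have "0 \<le> X" "0 \<le> Y" unfolding X_def Y_def using int by (auto intro!: integral_nonneg)
    then have "0 \<le> B * Y" using B_pos by simp
    with \<open>0 \<le> X\<close> show ?thesis by (simp add: algebra_simps)
  qed
  also have "X + Y = integral {s..t} (\<lambda>x. \<bar>u x\<bar> + \<bar>v x\<bar>)"
    unfolding X_def Y_def using int by (intro Henstock_Kurzweil_Integration.integral_add[symmetric])
  finally show ?thesis .
qed

definition growth :: real where "growth = 2 * exp (2 * (B + 1) * pi)"

text \<open>Gronwall's inequality in both directions from \<open>z\<close>. The maximum of \<open>\<bar>u\<bar> + \<bar>v\<bar>\<close> weighted by
  \<open>exp (- L \<bar>x - z\<bar>)\<close> is at most the value at \<open>z\<close> plus half of that maximum.\<close>

lemma admissible_gronwall: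
  assumes uv: "admissible u v" and z: "z \<in> {0..pi}" and x: "x \<in> {0..pi}"
  shows "\<bar>u x\<bar> + \<bar>v x\<bar> \<le> growth * (\<bar>u z\<bar> + \<bar>v z\<bar>)"
proof -
  define m where "m = (\<lambda>x. \<bar>u x\<bar> + \<bar>v x\<bar>)"
  \<comment> \<open>Twice the Lipschitz constant, so that integrating the weight costs exactly the factor one half.\<close>
  define L where "L = 2 * (B + 1)"
  have L: "L > 0" "(B + 1) / L = 1 / 2" using B_pos by (auto simp: L_def)
  have cm: "continuous_on {0..pi} m"
    unfolding m_def by (intro continuous_intros admissibleD[OF uv])
  then have "continuous_on {0..pi} (\<lambda>x. exp (- L * \<bar>x - z\<bar>) * m x)"
    by (intro continuous_intros)
  then obtain y where y: "y \<in> {0..pi}"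
    and max: "\<And>x. x \<in> {0..pi} \<Longrightarrow> exp (- L * \<bar>x - z\<bar>) * m x \<le> exp (- L * \<bar>y - z\<bar>) * m y"
    using continuous_attains_sup[of "{0..pi}" "\<lambda>x. exp (- L * \<bar>x - z\<bar>) * m x"] z by fastforce
  define M where "M = exp (- L * \<bar>y - z\<bar>) * m y"
  have m_le: "m x \<le> M * exp (L * \<bar>x - z\<bar>)" if "x \<in> {0..pi}" for x
    using max[OF that] by (simp add: M_def exp_minus field_simps)
  have "M \<ge> 0" by (simp add: M_def m_def)
  have "m y \<le> m z + M * exp (L * \<bar>y - z\<bar>) / 2"
  proof (cases "z \<le> y")
    case True
    have zy: "0 \<le> z" "z \<le> y" "y \<le> pi" using True z y by auto
    have "((\<lambda>x. M * exp (L * (x - z))) has_integral M * exp (L * (y - z)) / L - M * exp (L * (z - z)) / L) {z..y}"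
      using True L by (intro fundamental_theorem_of_calculus)
        (auto simp flip: has_real_derivative_iff_has_vector_derivative intro!: derivative_eq_intros)
    moreover have "m integrable_on {z..y}"
      using zy by (intro integrable_continuous_real continuous_on_subset[OF cm]) auto
    ultimately have "integral {z..y} m \<le> M * exp (L * (y - z)) / L - M * exp (L * (z - z)) / L"
    proof (intro has_integral_le[OF integrable_integral])
      show "m x \<le> M * exp (L * (x - z))" if "x \<in> {z..y}" for x
        using m_le[of x] that zy by simp
    qed
    also have "\<dots> \<le> M * exp (L * (y - z)) / L" using \<open>M \<ge> 0\<close> L by simp
    finally have "(B + 1) * integral {z..y} m \<le> (B + 1) * (M * exp (L * (y - z)) / L)"
      using B_pos by (intro mult_left_mono) auto
    moreover have "(B + 1) * (M * exp (L * (y - z)) / L) = M * exp (L * \<bar>y - z\<bar>) / 2"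
      using L True by (simp add: field_simps)
    moreover have "m y \<le> m z + (B + 1) * integral {z..y} m"
      using admissible_growth[OF uv zy] unfolding m_def by linarith
    ultimately show ?thesis by linarith
  next
    case False
    have zy: "0 \<le> y" "y \<le> z" "z \<le> pi" using False z y by auto
    have "((\<lambda>x. M * exp (L * (z - x))) has_integral - (M * exp (L * (z - z)) / L) - - (M * exp (L * (z - y)) / L)) {y..z}"
      using zy L(1) by (intro fundamental_theorem_of_calculus)
        (auto simp flip: has_real_derivative_iff_has_vector_derivative intro!: derivative_eq_intros)
    moreover have "m integrable_on {y..z}"
      using zy by (intro integrable_continuous_real continuous_on_subset[OF cm]) auto
    ultimately have "integral {y..z} m \<le> - (M * exp (L * (z - z)) / L) - - (M * exp (L * (z - y)) / L)"
    proof (intro has_integral_le[OF integrable_integral])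
      show "m x \<le> M * exp (L * (z - x))" if "x \<in> {y..z}" for x
        using m_le[of x] that zy by simp
    qed
    also have "\<dots> \<le> M * exp (L * (z - y)) / L" using \<open>M \<ge> 0\<close> L by simp
    finally have "(B + 1) * integral {y..z} m \<le> (B + 1) * (M * exp (L * (z - y)) / L)"
      using B_pos by (intro mult_left_mono) auto
    moreover have "(B + 1) * (M * exp (L * (z - y)) / L) = M * exp (L * \<bar>y - z\<bar>) / 2"
      using L False by (simp add: field_simps)
    moreover have "m y \<le> m z + (B + 1) * integral {y..z} m"
      using admissible_growth[OF uv zy] unfolding m_def by linarith
    ultimately show ?thesis by linarith
  qed
  then have "exp (- L * \<bar>y - z\<bar>) * m y \<le> exp (- L * \<bar>y - z\<bar>) * (m z + M * exp (L * \<bar>y - z\<bar>) / 2)"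
    by (intro mult_left_mono) auto
  also have "\<dots> = exp (- L * \<bar>y - z\<bar>) * m z + M / 2"
    by (simp add: distrib_left exp_minus)
  also have "\<dots> \<le> m z + M / 2"
  proof -
    have "exp (- L * \<bar>y - z\<bar>) \<le> 1" using L(1) by simp
    then have "exp (- L * \<bar>y - z\<bar>) * m z \<le> 1 * m z"
      by (rule mult_right_mono) (simp add: m_def)
    then show ?thesis by simp
  qed
  finally have "M \<le> 2 * m z" by (simp add: M_def)
  have "\<bar>x - z\<bar> \<le> pi" using x z by auto
  then have "exp (L * \<bar>x - z\<bar>) \<le> exp (L * pi)" using L by simp
  then have "M * exp (L * \<bar>x - z\<bar>) \<le> (2 * m z) * exp (L * pi)"
    using \<open>M \<le> 2 * m z\<close> \<open>M \<ge> 0\<close> by (intro mult_mono) auto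
  also have "\<dots> = growth * m z" by (simp add: growth_def L_def)
  finally show ?thesis using m_le[OF x] by (simp add: m_def)
qed

lemma admissible_eq_zero:
  assumes "admissible u v" "z \<in> {0..pi}" "u z = 0" "v z = 0" "x \<in> {0..pi}"
  shows "u x = 0"
  using admissible_gronwall[OF assms(1,2,5)] assms(3,4) by simp

subsection \<open>Sturm comparison and uniqueness of the trivial periodic solution\<close>

text \<open>The two intervals with constant upper bound, each shorter than the half turn \<open>\<pi> / sqrt \<kappa>\<close>.\<close>

definition piece :: "real \<Rightarrow> real \<Rightarrow> real \<Rightarrow> bool" where
  "piece l r \<kappa> \<longleftrightarrow> l = 0 \<and> r = x0 \<and> \<kappa> = k1 \<or> l = x0 \<and> r = pi \<and> \<kappa> = k2"

lemma pieceD: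
  assumes "piece l r \<kappa>"
  shows "0 \<le> l" "l < r" "r \<le> pi" "0 \<le> \<kappa>" "\<kappa> < (pi / (r - l))\<^sup>2"
    and "\<And>x. l \<le> x \<Longrightarrow> x < r \<Longrightarrow> k x = \<kappa>"
  using assms x0 k_nonneg left_small right_small
  by (auto simp: piece_def k_def power_divide pos_less_divide_eq)

lemma one_sided_bound:
  assumes uv: "admissible u v" and lr: "piece l r \<kappa>" and st: "l \<le> s" "s \<le> t" "t \<le> r"
    and pos: "\<And>x. x \<in> {s..t} \<Longrightarrow> 0 \<le> u x"
  shows "v s - v t \<le> \<kappa> * integral {s..t} u"
proof -
  note P = pieceD[OF lr]
  have "v s - v t \<le> integral {s..t} (upper u)"
    using P st by (intro admissibleD(5)[OF uv]) auto
  also have "\<dots> = integral {s..t} (\<lambda>x. \<kappa> * u x)"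
  proof (rule integral_spike[of "{r}"])
    show "\<kappa> * u x = upper u x" if "x \<in> {s..t} - {r}" for x
      using that pos[of x] P(6)[of x] st by (simp add: upper_def)
  qed simp
  finally show ?thesis by simp
qed

text \<open>The Wronskian with the half-turn sinusoid of the piece decreases as long as \<open>u\<close> and \<open>\<phi>\<close> have the
  same sign.\<close>

lemma sturm_comparison:
  fixes \<phi> \<psi> :: "real \<Rightarrow> real"
  assumes uv: "admissible u v" and lr: "piece l r \<kappa>" and st: "l \<le> s" "s \<le> t" "t \<le> r"
    and \<phi>: "\<And>x. (\<phi> has_real_derivative \<psi> x) (at x)"
    and \<psi>: "\<And>x. (\<psi> has_real_derivative - ((pi / (r - l))\<^sup>2) * \<phi> x) (at x)"
    and sign: "(\<forall>x\<in>{s..t}. 0 \<le> u x \<and> 0 \<le> \<phi> x) \<or> (\<forall>x\<in>{s..t}. u x \<le> 0 \<and> \<phi> x \<le> 0)"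
  shows "u t * \<psi> t - v t * \<phi> t \<le> u s * \<psi> s - v s * \<phi> s"
    and "s < t \<Longrightarrow> p \<in> {s..t} \<Longrightarrow> u p * \<phi> p \<noteq> 0 \<Longrightarrow> u t * \<psi> t - v t * \<phi> t < u s * \<psi> s - v s * \<phi> s"
proof -
  note P = pieceD[OF lr]
  define I where "I = integral {s..t} (\<lambda>x. u x * \<phi> x)"
  define w where "w = pi / (r - l)"
  have \<psi>': "\<And>x. (\<psi> has_real_derivative - (w\<^sup>2) * \<phi> x) (at x)" using \<psi> by (simp add: w_def)
  have gap: "0 < w\<^sup>2 - \<kappa>" using P(5) by (simp add: w_def)
  have sub: "{s..t} \<subseteq> {0..pi}" using P st by auto
  have cont: "continuous_on {s..t} (\<lambda>x. u x * \<phi> x)"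
    using \<phi> by (intro continuous_intros continuous_on_subset[OF admissibleD(2)[OF uv] sub])
      (meson DERIV_isCont continuous_at_imp_continuous_on)
  have le: "(u t * \<psi> t - v t * \<phi> t) - (u s * \<psi> s - v s * \<phi> s) \<le> - (w\<^sup>2 - \<kappa>) * I"
    using sign
  proof
    assume pos: "\<forall>x\<in>{s..t}. 0 \<le> u x \<and> 0 \<le> \<phi> x"
    show ?thesis
      unfolding I_def
    proof (rule sturm_wronskian_le[OF \<open>s \<le> t\<close> _ _ _ \<phi> \<psi>'])
      show "(u has_real_derivative v x) (at x within {s..t})" if "x \<in> {s..t}" for x
        using that sub by (auto intro: DERIV_subset[OF admissibleD(1)[OF uv]])
      show "continuous_on {s..t} v" using admissibleD(3)[OF uv] sub by (rule continuous_on_subset)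
      show "v x - v y \<le> \<kappa> * integral {x..y} u" if "s \<le> x" "x \<le> y" "y \<le> t" for x y
        using that st pos by (intro one_sided_bound[OF uv lr]) auto
    qed (use pos in auto)
  next
    assume neg: "\<forall>x\<in>{s..t}. u x \<le> 0 \<and> \<phi> x \<le> 0"
    note uv' = admissible_minus[OF uv]
    have "(- u t * - \<psi> t - - v t * - \<phi> t) - (- u s * - \<psi> s - - v s * - \<phi> s)
        \<le> - (w\<^sup>2 - \<kappa>) * integral {s..t} (\<lambda>x. - u x * - \<phi> x)"
    proof (rule sturm_wronskian_le[OF \<open>s \<le> t\<close>])
      show "((\<lambda>x. - u x) has_real_derivative - v x) (at x within {s..t})" if "x \<in> {s..t}" for x
        using that sub by (auto intro: DERIV_subset[OF admissibleD(1)[OF uv']])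
      show "continuous_on {s..t} (\<lambda>x. - v x)" using admissibleD(3)[OF uv'] sub by (rule continuous_on_subset)
      show "- v x - - v y \<le> \<kappa> * integral {x..y} (\<lambda>x. - u x)" if "s \<le> x" "x \<le> y" "y \<le> t" for x y
        using that st neg by (intro one_sided_bound[OF uv' lr]) auto
      show "((\<lambda>x. - \<phi> x) has_real_derivative - \<psi> x) (at x)" for x
        by (intro derivative_intros \<phi>)
      show "((\<lambda>x. - \<psi> x) has_real_derivative - (w\<^sup>2) * - \<phi> x) (at x)" for x
        using DERIV_minus[OF \<psi>'[of x]] by simp
    qed (use neg in auto)
    then show ?thesis by (simp add: I_def)
  qed
  have nonneg: "0 \<le> u x * \<phi> x" if "x \<in> {s..t}" for x
    using sign that by (auto intro: mult_nonneg_nonneg mult_nonpos_nonpos)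
  have "0 \<le> I"
    unfolding I_def using cont nonneg by (intro integral_nonneg integrable_continuous_real) auto
  with gap have "0 \<le> (w\<^sup>2 - \<kappa>) * I" by simp
  with le show "u t * \<psi> t - v t * \<phi> t \<le> u s * \<psi> s - v s * \<phi> s" by linarith
  assume p: "s < t" "p \<in> {s..t}" "u p * \<phi> p \<noteq> 0"
  then have "0 < u p * \<phi> p" unfolding less_le using nonneg[OF p(2)] by metis
  then have "0 < I"
    unfolding I_def using p by (intro integral_pos_of_continuous[OF cont nonneg]) auto
  with gap have "0 < (w\<^sup>2 - \<kappa>) * I" by simp
  with le show "u t * \<psi> t - v t * \<phi> t < u s * \<psi> s - v s * \<phi> s" by linarith
qed

text \<open>Compare a positive arch of \<open>u\<close> with the sine that starts at the left foot of the arch. The arch is at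
  most half a turn long, so the sine is still nonnegative at the right foot, where \<open>u\<close> is falling.
  The Wronskian then starts at zero and ends nonnegative, but it has to decrease strictly.\<close>

lemma no_bump_in_piece:
  assumes uv: "admissible u v" and lr: "piece l r \<kappa>"
    and z: "l \<le> z1" "z1 < p" "p < z2" "z2 \<le> r" "u z1 = 0" "u z2 = 0"
  shows "u p \<le> 0"
proof (rule ccontr)
  assume "\<not> u p \<le> 0"
  then have "0 < u p" by simp
  note P = pieceD[OF lr]
  have sub: "{z1..p} \<subseteq> {0..pi}" "{p..z2} \<subseteq> {0..pi}" using P z by auto
  obtain s where s: "z1 \<le> s" "s < p" "u s = 0" "\<And>x. s < x \<Longrightarrow> x \<le> p \<Longrightarrow> 0 < u x"
    using last_zero_before[OF continuous_on_subset[OF admissibleD(2)[OF uv] sub(1)] z(2,5) \<open>0 < u p\<close>] by metis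
  obtain t where t: "p < t" "t \<le> z2" "u t = 0" "\<And>x. p \<le> x \<Longrightarrow> x < t \<Longrightarrow> 0 < u x"
    using first_zero_after[OF continuous_on_subset[OF admissibleD(2)[OF uv] sub(2)] z(3,6) \<open>0 < u p\<close>] by metis
  have pos: "0 < u x" if "s < x" "x < t" for x
    using that s(4)[of x] t(4)[of x] by (cases "x \<le> p") auto
  define w where "w = pi / (r - l)"
  define \<phi> where "\<phi> = (\<lambda>x. sin (w * (x - s)))"
  define \<psi> where "\<psi> = (\<lambda>x. w * cos (w * (x - s)))"
  have w: "w > 0" "w * (r - l) = pi" using P by (auto simp: w_def)
  have half_turn: "0 \<le> w * (x - s)" "w * (x - s) \<le> pi" if "s \<le> x" "x \<le> t" for x
    using that w s t z by (auto simp flip: w(2) intro!: mult_left_mono)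
  have "u t * \<psi> t - v t * \<phi> t < u s * \<psi> s - v s * \<phi> s"
  proof (rule sturm_comparison(2)[OF uv lr, of s t \<phi> \<psi> p])
    show "(\<phi> has_real_derivative \<psi> x) (at x)" for x
      unfolding \<phi>_def \<psi>_def by (auto intro!: derivative_eq_intros)
    show "(\<psi> has_real_derivative - ((pi / (r - l))\<^sup>2) * \<phi> x) (at x)" for x
      unfolding \<phi>_def \<psi>_def w_def[symmetric]
      by (auto intro!: derivative_eq_intros simp: power2_eq_square)
    have "0 \<le> u x" if "x \<in> {s..t}" for x
      using that pos[of x] s(3) t(3) by (cases "x = s \<or> x = t") auto
    then show "(\<forall>x\<in>{s..t}. 0 \<le> u x \<and> 0 \<le> \<phi> x) \<or> (\<forall>x\<in>{s..t}. u x \<le> 0 \<and> \<phi> x \<le> 0)"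
      using half_turn by (auto simp: \<phi>_def intro!: sin_ge_zero)
    have "w * (p - s) < w * (r - l)"
      using w(1) s t z by (intro mult_strict_left_mono) auto
    then have "0 < \<phi> p"
      unfolding \<phi>_def using w s by (intro sin_gt_zero) auto
    then show "u p * \<phi> p \<noteq> 0" using \<open>0 < u p\<close> by simp
  qed (use s t z in auto)
  moreover have "v t \<le> 0"
  proof (rule DERIV_le_0_at_right_zero[OF admissibleD(1)[OF uv]])
    show "0 \<le> u x" if "s < x" "x < t" for x using pos[OF that] by simp
    show "t \<in> {0..pi}" "0 \<le> s" "s < t" "t \<le> pi" "u t = 0" using s t z P by auto
  qed
  moreover have "0 \<le> \<phi> t"
    using half_turn[of t] s t by (auto simp: \<phi>_def intro!: sin_ge_zero)
  ultimately show False
    using s(3) t(3) mult_nonpos_nonneg[of "v t" "\<phi> t"] by (simp add: \<phi>_def)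
qed

lemma zero_unique_in_piece:
  assumes uv: "admissible u v" and lr: "piece l r \<kappa>"
    and z: "z1 \<in> {l..r}" "z2 \<in> {l..r}" "u z1 = 0" "u z2 = 0"
    and nontriv: "x \<in> {0..pi}" "u x \<noteq> 0"
  shows "z1 = z2"
proof -
  have "\<not> z1 < z2" if z: "z1 \<in> {l..r}" "z2 \<in> {l..r}" "u z1 = 0" "u z2 = 0" for z1 z2
  proof
    assume "z1 < z2"
    note P = pieceD[OF lr]
    have zero: "u p = 0" if "z1 < p" "p < z2" for p
      using no_bump_in_piece[OF uv lr, of z1 p z2] no_bump_in_piece[OF admissible_minus[OF uv] lr, of z1 p z2]
        that z by simp
    define p where "p = (z1 + z2) / 2"
    have p: "z1 < p" "p < z2" "p \<in> {0..pi}" using \<open>z1 < z2\<close> z P by (auto simp: p_def)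
    have "(u has_real_derivative v p) (at p within {z1<..<z2})"
      using z P p by (intro DERIV_subset[OF admissibleD(1)[OF uv]]) auto
    then have "(u has_real_derivative v p) (at p)"
      using p by (simp add: at_within_open[of p "{z1<..<z2}"])
    moreover have "(u has_real_derivative 0) (at p)"
      by (rule has_field_derivative_transform_within_open[OF DERIV_const[of 0], of "{z1<..<z2}"])
        (use p zero in auto)
    ultimately have "v p = 0" by (rule DERIV_unique)
    then have "u x = 0"
      using admissible_eq_zero[OF uv p(3) zero[OF p(1,2)] _ nontriv(1)] by simp
    with nontriv show False by simp
  qed
  from this[of z1 z2] this[of z2 z1] z show ?thesis by force
qed

lemma pieces: "piece 0 x0 k1" "piece x0 pi k2"
  by (simp_all add: piece_def)

lemma finite_zeros:
  assumes uv: "admissible u v" and nontriv: "x \<in> {0..pi}" "u x \<noteq> 0"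
  shows "finite {z \<in> {0..pi}. u z = 0}"
proof -
  have *: "finite {z \<in> {l..r}. u z = 0}" if "piece l r \<kappa>" for l r \<kappa>
  proof -
    have "{z \<in> {l..r}. u z = 0} \<subseteq> {z0}" if "z0 \<in> {z \<in> {l..r}. u z = 0}" for z0
      using zero_unique_in_piece[OF uv \<open>piece l r \<kappa>\<close>] that nontriv by blast
    then show ?thesis by (metis (no_types, lifting) ex_in_conv finite.emptyI finite_insert finite_subset)
  qed
  have "{z \<in> {0..pi}. u z = 0} = {z \<in> {0..x0}. u z = 0} \<union> {z \<in> {x0..pi}. u z = 0}"
    using x0 by auto
  then show ?thesis using *[OF pieces(1)] *[OF pieces(2)] by simp
qed

text \<open>If \<open>u \<ge> 0\<close>, then periodicity of \<open>u'\<close> forces \<open>\<integral> a u \<le> 0\<close>. Hence \<open>u\<close> vanishes almost everywhere on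
  the non-null set where \<open>a\<close> is positive, which is impossible for a function with finitely many zeros.\<close>

lemma periodic_takes_negative_value:
  assumes uv: "admissible u v" and per: "v 0 = v pi" and nontriv: "x \<in> {0..pi}" "u x \<noteq> 0"
  shows "\<exists>n\<in>{0..pi}. u n < 0"
proof (rule ccontr)
  assume "\<not> ?thesis"
  then have pos: "0 \<le> u x" if "x \<in> {0..pi}" for x using that by (meson not_le)
  have eq: "lower u x = a x * u x" if "x \<in> {0..pi}" for x
    using pos[OF that] by (simp add: lower_def)
  have nonneg: "0 \<le> lower u x" if "x \<in> {0..pi}" for x
    using eq[OF that] pos[OF that] a_nonneg[of x] by simp
  have int: "lower u integrable_on {0..pi}"
    by (rule bounds_integrable(1)[OF admissibleD(2)[OF uv]])
  have "integral {0..pi} (lower u) \<le> 0"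
    using admissibleD(4)[OF uv, of 0 pi] per by simp
  moreover have "0 \<le> integral {0..pi} (lower u)"
    using nonneg by (intro integral_nonneg int)
  ultimately have "(lower u has_integral 0) {0..pi}" using int by (simp add: has_integral_iff)
  then have "negligible {x \<in> {0..pi}. lower u x \<noteq> 0}"
    using nonneg by (intro has_integral_0_nonneg_negligible) auto
  moreover have "negligible {z \<in> {0..pi}. u z = 0}"
    using finite_zeros[OF uv nontriv] by (rule negligible_finite)
  ultimately have "negligible ({x \<in> {0..pi}. lower u x \<noteq> 0} \<union> {z \<in> {0..pi}. u z = 0})"
    by (rule negligible_Un)
  then have "negligible {x \<in> {0..pi}. 0 < a x}"
    by (rule negligible_subset) (use eq in auto)
  with a_not_null show False by simp
qed

text \<open>Such a \<open>u\<close> has exactly two zeros \<open>z1 < x0 < z2\<close>, one in each piece. Let \<open>\<phi>\<close> be the solution of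
  the comparison equation that vanishes at \<open>z1\<close>, given by \<open>\<phi>1\<close> on \<open>[0, x0]\<close> and by \<open>\<phi>2\<close> on
  \<open>[x0, \<pi>]\<close>. Because each piece is a half turn for \<open>\<phi>\<close>, its values and slopes at \<open>0\<close> and at \<open>\<pi>\<close>
  agree, and so do those of the Wronskian \<open>W\<close> of \<open>u\<close> and \<open>\<phi>\<close>. Starting from \<open>W z1 = 0\<close>, the Wronskian is
  negative at \<open>x0\<close> and positive at \<open>0\<close>, hence also at \<open>\<pi>\<close>. Whichever sign \<open>\<phi>\<close> has at \<open>z2\<close>, on one
  side of \<open>z2\<close> the functions \<open>u\<close> and \<open>\<phi>\<close> have the same sign, and monotonicity of \<open>W\<close> on that side is
  incompatible with \<open>W z2 = - u' z2 * \<phi> z2\<close>.\<close>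

lemma periodic_positive_start_impossible:
  assumes uv: "admissible u v" and per: "u 0 = u pi" "v 0 = v pi" and u0: "0 < u 0"
  shows False
proof -
  have nontriv: "0 \<in> {0..pi}" "u 0 \<noteq> 0" using u0 by auto
  have cu: "continuous_on {p..q} u" if "0 \<le> p" "q \<le> pi" for p q
    using that by (intro continuous_on_subset[OF admissibleD(2)[OF uv]]) auto
  obtain n where n: "n \<in> {0..pi}" "u n < 0"
    using periodic_takes_negative_value[OF uv per(2) nontriv] by blast
  obtain z1 where z1: "0 \<le> z1" "z1 \<le> n" "u z1 = 0"
    using IVT2'[of u n 0 0] cu[of 0 n] n u0 by force
  obtain z2 where z2: "n \<le> z2" "z2 \<le> pi" "u z2 = 0"
    using IVT'[of u n 0 pi] cu[of n pi] n u0 per by force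
  note left = zero_unique_in_piece[OF uv pieces(1) _ _ _ _ nontriv]
  note right = zero_unique_in_piece[OF uv pieces(2) _ _ _ _ nontriv]
  have "z1 < n" "n < z2" using z1 z2 n by (auto simp: le_less)
  then have "z1 \<noteq> z2" by simp
  have order: "0 < z1" "z1 < x0" "x0 < z2" "z2 < pi"
  proof -
    show "0 < z1" using z1 u0 by (auto simp: le_less)
    show "z2 < pi" using z2 u0 per by (auto simp: le_less)
    show "z1 < x0"
      using right[of z1 z2] z1 z2 \<open>z1 < n\<close> \<open>n < z2\<close> n by force
    show "x0 < z2"
      using left[of z1 z2] z1 z2 \<open>z1 < n\<close> \<open>n < z2\<close> n by force
  qed
  have zeros: "z = z1 \<or> z = z2" if "z \<in> {0..pi}" "u z = 0" for z
    using left[of z z1] right[of z z2] that z1 z2 order by (cases "z \<le> x0") auto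
  have pos_left: "0 < u x" if "0 \<le> x" "x < z1" for x
  proof -
    have "u y \<noteq> 0" if "y \<in> {0..x}" for y
      using zeros[of y] that \<open>x < z1\<close> order x0 by auto
    then show ?thesis
      using continuous_nonzero_same_sign[OF cu[of 0 x]] that order x0 u0 by auto
  qed
  have pos_right: "0 < u x" if "z2 < x" "x \<le> pi" for x
  proof -
    have "u y \<noteq> 0" if "y \<in> {x..pi}" for y
      using zeros[of y] that \<open>z2 < x\<close> order x0 by auto
    then show ?thesis
      using continuous_nonzero_same_sign[OF cu[of x pi]] that order x0 u0 per by auto
  qed
  have neg_mid: "u x < 0" if "z1 < x" "x < z2" for x
  proof -
    have nz: "u y \<noteq> 0" if "z1 < y" "y < z2" for y
      using zeros[of y] that order by auto
    have "\<not> 0 < u x"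
    proof (cases "x \<le> n")
      case True
      then show ?thesis
        using continuous_nonzero_same_sign[OF cu[of x n]] nz that order n \<open>n < z2\<close> by auto
    next
      case False
      then show ?thesis
        using continuous_nonzero_same_sign[OF cu[of n x]] nz that order n \<open>z1 < n\<close> by auto
    qed
    with nz[OF that] show ?thesis by simp
  qed
  have vz2: "0 \<le> v z2"
    using DERIV_le_0_at_right_zero[OF admissibleD(1)[OF admissible_minus[OF uv]], of z2 z1]
      neg_mid z2 order by (force simp: less_imp_le)

  \<comment> \<open>The frequencies for which each piece is exactly half a turn long.\<close>
  define w1 where "w1 = pi / x0"
  define w2 where "w2 = pi / (pi - x0)"
  have w: "0 < w1" "0 < w2" "w1 * x0 = pi" "w2 * (pi - x0) = pi"
    using x0 by (auto simp: w1_def w2_def)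
  define \<phi>1 where "\<phi>1 = (\<lambda>x. sin (w1 * (z1 - x)))"
  define \<psi>1 where "\<psi>1 = (\<lambda>x. - w1 * cos (w1 * (z1 - x)))"
  define A where "A = \<phi>1 x0"
  define D where "D = \<psi>1 x0"
  define \<phi>2 where "\<phi>2 = (\<lambda>x. A * cos (w2 * (x - x0)) + D / w2 * sin (w2 * (x - x0)))"
  define \<psi>2 where "\<psi>2 = (\<lambda>x. - w2 * A * sin (w2 * (x - x0)) + D * cos (w2 * (x - x0)))"
  have \<phi>1: "(\<phi>1 has_real_derivative \<psi>1 x) (at x)" for x
    unfolding \<phi>1_def \<psi>1_def by (auto intro!: derivative_eq_intros)
  have \<psi>1: "(\<psi>1 has_real_derivative - ((pi / (x0 - 0))\<^sup>2) * \<phi>1 x) (at x)" for x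
    unfolding \<phi>1_def \<psi>1_def diff_0_right w1_def[symmetric]
    by (auto intro!: derivative_eq_intros simp: power2_eq_square)
  have \<phi>2: "(\<phi>2 has_real_derivative \<psi>2 x) (at x)" for x
    unfolding \<phi>2_def \<psi>2_def using w(2) by (auto intro!: derivative_eq_intros simp: field_simps)
  have \<psi>2: "(\<psi>2 has_real_derivative - ((pi / (pi - x0))\<^sup>2) * \<phi>2 x) (at x)" for x
    unfolding \<phi>2_def \<psi>2_def w2_def[symmetric] using w(2)
    by (auto intro!: derivative_eq_intros simp: power2_eq_square field_simps)
  have "w1 * (z1 - x0) = w1 * z1 - pi" using w by (simp add: algebra_simps)
  \<comment> \<open>Half a turn on each side reverses the Cauchy data.\<close>
  then have half1: "\<phi>1 0 = - A" "\<psi>1 0 = - D"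
    by (simp_all add: A_def D_def \<phi>1_def \<psi>1_def sin_diff cos_diff)
  have half2: "\<phi>2 x0 = A" "\<psi>2 x0 = D" "\<phi>2 pi = - A" "\<psi>2 pi = - D"
    using w by (simp_all add: \<phi>2_def \<psi>2_def)
  have "w1 * z1 < w1 * x0" using w(1) order by simp
  then have "A < 0"
    using half1(1) sin_gt_zero[of "w1 * z1"] w order by (simp add: \<phi>1_def)

  define W1 where "W1 = (\<lambda>x. u x * \<psi>1 x - v x * \<phi>1 x)"
  define W2 where "W2 = (\<lambda>x. u x * \<psi>2 x - v x * \<phi>2 x)"
  have join: "W1 x0 = W2 x0" "W2 pi = W1 0"
    using half1 half2 per by (simp_all add: W1_def W2_def A_def D_def)
  have Wz1: "W1 z1 = 0" using z1 by (simp add: W1_def \<phi>1_def)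
  have Wz2: "W2 z2 = - v z2 * \<phi>2 z2" using z2 by (simp add: W2_def)
  have \<phi>1_pos: "0 < \<phi>1 x" if "0 \<le> x" "x < z1" for x
  proof -
    have "w1 * (z1 - x) < w1 * x0" using w(1) that order by simp
    then show ?thesis
      unfolding \<phi>1_def using w that by (intro sin_gt_zero) auto
  qed
  have \<phi>1_neg: "\<phi>1 x < 0" if "z1 < x" "x \<le> x0" for x
  proof -
    have "w1 * (x - z1) < w1 * x0" using w(1) that order by simp
    then have "0 < sin (w1 * (x - z1))" using w that by (intro sin_gt_zero) auto
    moreover have "w1 * (z1 - x) = - (w1 * (x - z1))" by (simp add: algebra_simps)
    ultimately show ?thesis by (simp add: \<phi>1_def)
  qed
  have "W1 z1 < W1 0"
    unfolding W1_def
  proof (rule sturm_comparison(2)[OF uv pieces(1) _ _ _ \<phi>1 \<psi>1, where p=0])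
    have "0 \<le> u x \<and> 0 \<le> \<phi>1 x" if "x \<in> {0..z1}" for x
      using pos_left[of x] \<phi>1_pos[of x] that z1(3) by (cases "x = z1") (auto simp: \<phi>1_def)
    then show "(\<forall>x\<in>{0..z1}. 0 \<le> u x \<and> 0 \<le> \<phi>1 x) \<or> (\<forall>x\<in>{0..z1}. u x \<le> 0 \<and> \<phi>1 x \<le> 0)" by blast
    show "u 0 * \<phi>1 0 \<noteq> 0" using u0 \<phi>1_pos[of 0] order by simp
  qed (use order in auto)
  then have W_pi: "0 < W2 pi" using Wz1 join by simp
  have "W1 x0 < W1 z1"
    unfolding W1_def
  proof (rule sturm_comparison(2)[OF uv pieces(1) _ _ _ \<phi>1 \<psi>1, where p=x0])
    have "u x \<le> 0 \<and> \<phi>1 x \<le> 0" if "x \<in> {z1..x0}" for x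
      using neg_mid[of x] \<phi>1_neg[of x] that z1(3) order by (cases "x = z1") (auto simp: \<phi>1_def)
    then show "(\<forall>x\<in>{z1..x0}. 0 \<le> u x \<and> 0 \<le> \<phi>1 x) \<or> (\<forall>x\<in>{z1..x0}. u x \<le> 0 \<and> \<phi>1 x \<le> 0)" by blast
    show "u x0 * \<phi>1 x0 \<noteq> 0" using neg_mid[of x0] \<phi>1_neg[of x0] order by simp
  qed (use order in auto)
  then have W_x0: "W2 x0 < 0" using Wz1 join by simp
  show False
  \<comment> \<open>For \<open>\<phi> z2 \<le> 0\<close> the signs agree on \<open>[x0, z2]\<close>, where both are nonpositive; otherwise they agree on
    \<open>[z2, \<pi>]\<close>, where both are nonnegative.\<close>
  proof (cases "\<phi>2 z2 \<le> 0")
    case True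
    have "W2 z2 \<le> W2 x0"
      unfolding W2_def
    proof (rule sturm_comparison(1)[OF uv pieces(2) _ _ _ \<phi>2 \<psi>2])
      have gap: "w2 * (z2 - x0) < pi"
        using mult_strict_left_mono[of "z2 - x0" "pi - x0" w2] w(2,4) order by simp
      have "\<phi>2 x \<le> 0" if x: "x \<in> {x0..z2}" for x
      proof -
        have "0 \<le> - A * cos (w2 * (x - x0)) + - (D / w2) * sin (w2 * (x - x0))"
        proof (rule sinusoid_nonneg_between[OF w(2) gap])
          show "0 \<le> - A * cos (w2 * (x0 - x0)) + - (D / w2) * sin (w2 * (x0 - x0))"
            using \<open>A < 0\<close> by simp
          show "0 \<le> - A * cos (w2 * (z2 - x0)) + - (D / w2) * sin (w2 * (z2 - x0))"
            using True unfolding \<phi>2_def by linarith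
        qed (use x order in auto)
        then show ?thesis unfolding \<phi>2_def by linarith
      qed
      moreover have "u x \<le> 0" if "x \<in> {x0..z2}" for x
        using neg_mid[of x] that z2(3) order by (cases "x = z2") auto
      ultimately show "(\<forall>x\<in>{x0..z2}. 0 \<le> u x \<and> 0 \<le> \<phi>2 x) \<or> (\<forall>x\<in>{x0..z2}. u x \<le> 0 \<and> \<phi>2 x \<le> 0)"
        by blast
    qed (use order in auto)
    moreover have "v z2 * \<phi>2 z2 \<le> 0" using vz2 True by (rule mult_nonneg_nonpos)
    ultimately show False using W_x0 Wz2 by simp
  next
    case False
    have "W2 pi \<le> W2 z2"
      unfolding W2_def
    proof (rule sturm_comparison(1)[OF uv pieces(2) _ _ _ \<phi>2 \<psi>2])
      have gap: "w2 * (pi - z2) < pi"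
        using mult_strict_left_mono[of "pi - z2" "pi - x0" w2] w(2,4) order by simp
      have "0 \<le> \<phi>2 x" if x: "x \<in> {z2..pi}" for x
        unfolding \<phi>2_def
      proof (rule sinusoid_nonneg_between[OF w(2) gap])
        show "0 \<le> A * cos (w2 * (z2 - x0)) + D / w2 * sin (w2 * (z2 - x0))"
          using False unfolding \<phi>2_def by linarith
        show "0 \<le> A * cos (w2 * (pi - x0)) + D / w2 * sin (w2 * (pi - x0))"
          using half2(3) \<open>A < 0\<close> unfolding \<phi>2_def by linarith
      qed (use x order in auto)
      moreover have "0 \<le> u x" if "x \<in> {z2..pi}" for x
        using pos_right[of x] that z2(3) order by (cases "x = z2") auto
      ultimately show "(\<forall>x\<in>{z2..pi}. 0 \<le> u x \<and> 0 \<le> \<phi>2 x) \<or> (\<forall>x\<in>{z2..pi}. u x \<le> 0 \<and> \<phi>2 x \<le> 0)"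
        by blast
    qed (use order in auto)
    moreover have "0 \<le> v z2 * \<phi>2 z2" using vz2 False by simp
    ultimately show False using W_pi Wz2 by simp
  qed
qed

text \<open>Applied to \<open>u\<close> and to \<open>- u\<close>, the previous lemma leaves only the case \<open>u 0 = 0\<close>. Then \<open>0\<close> and \<open>\<pi>\<close> are the only zeros, so \<open>u\<close> has one sign in
  between, whereas a nontrivial periodic \<open>u\<close> takes values of both signs.\<close>

theorem periodic_admissible_zero:
  assumes uv: "admissible u v" and per: "u 0 = u pi" "v 0 = v pi" and x: "x \<in> {0..pi}"
  shows "u x = 0"
proof (rule ccontr)
  assume nz: "u x \<noteq> 0"
  note uv' = admissible_minus[OF uv]
  have "u 0 = 0"
    using periodic_positive_start_impossible[OF uv] periodic_positive_start_impossible[OF uv'] per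
    by force
  then have "u pi = 0" using per by simp
  have zeros: "z = 0 \<or> z = pi" if "z \<in> {0..pi}" "u z = 0" for z
    using zero_unique_in_piece[OF uv pieces(1) _ _ _ _ x nz, of z 0]
      zero_unique_in_piece[OF uv pieces(2) _ _ _ _ x nz, of z pi] that \<open>u 0 = 0\<close> \<open>u pi = 0\<close> x0
    by (cases "z \<le> x0") auto
  obtain n where n: "n \<in> {0..pi}" "u n < 0"
    using periodic_takes_negative_value[OF uv per(2) x nz] by blast
  obtain p where p: "p \<in> {0..pi}" "0 < u p"
    using periodic_takes_negative_value[OF uv' _ x] per nz by auto
  have "0 < p" "p < pi" "0 < n" "n < pi"
    using n p \<open>u 0 = 0\<close> \<open>u pi = 0\<close> by (auto simp: le_less)
  then have nz': "u z \<noteq> 0" if "min p n \<le> z" "z \<le> max p n" for z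
    using zeros[of z] that by (auto simp: min_def max_def split: if_splits)
  have cu: "continuous_on {min p n..max p n} u"
    using n p by (intro continuous_on_subset[OF admissibleD(2)[OF uv]]) auto
  have "0 < u (min p n) \<longleftrightarrow> 0 < u (max p n)"
    using nz' by (intro continuous_nonzero_same_sign[OF cu]) auto
  with n p show False by (auto simp: min_def max_def split: if_splits)
qed

subsection \<open>A uniform lower bound for the periodicity defect\<close>

lemma abs_max_diff_le: "\<bar>max 0 p - max 0 q\<bar> \<le> \<bar>p - q :: real\<bar>"
  by (auto simp: max_def)

lemma bounds_lipschitz:
  "\<bar>lower u x - lower w x\<bar> \<le> 2 * B * \<bar>u x - w x\<bar>" "\<bar>upper u x - upper w x\<bar> \<le> 2 * B * \<bar>u x - w x\<bar>"
proof -
  have 1: "\<bar>c * max 0 p - c * max 0 q\<bar> \<le> B * \<bar>p - q\<bar>" if "\<bar>c\<bar> \<le> B" for c p q :: real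
    using mult_mono[OF that abs_max_diff_le[of p q]] B_pos
    by (simp flip: right_diff_distrib add: abs_mult)
  have neg: "\<bar>- u x - - w x\<bar> = \<bar>u x - w x\<bar>" by simp
  have "lower u x - lower w x = (a x * max 0 (u x) - a x * max 0 (w x)) - (k x * max 0 (- u x) - k x * max 0 (- w x))"
    by (simp add: lower_def)
  then show "\<bar>lower u x - lower w x\<bar> \<le> 2 * B * \<bar>u x - w x\<bar>"
    using order_trans[OF abs_triangle_ineq4 add_mono[OF 1[OF k_bounds(4), of x "u x" "w x"] 1[OF k_bounds(3), of x "- u x" "- w x"]]]
    unfolding neg by simp
  have "upper u x - upper w x = (k x * max 0 (u x) - k x * max 0 (w x)) - (a x * max 0 (- u x) - a x * max 0 (- w x))"
    by (simp add: upper_def)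
  then show "\<bar>upper u x - upper w x\<bar> \<le> 2 * B * \<bar>u x - w x\<bar>"
    using order_trans[OF abs_triangle_ineq4 add_mono[OF 1[OF k_bounds(3), of x "u x" "w x"] 1[OF k_bounds(4), of x "- u x" "- w x"]]]
    unfolding neg by simp
qed

text \<open>The bounds are Lipschitz in \<open>u\<close>, so their integrals are controlled by \<open>\<integral> \<bar>U n - u\<bar>\<close>, which is an
  integral of continuous functions.\<close>

lemma bounds_integral_tendsto:
  assumes st: "0 \<le> s" "t \<le> pi"
    and un: "\<And>n. continuous_on {0..pi} (U n)" and u: "continuous_on {0..pi} u"
    and lim: "uniform_limit {0..pi} U u sequentially"
  shows "(\<lambda>n. integral {s..t} (lower (U n))) \<longlonglongrightarrow> integral {s..t} (lower u)"
    and "(\<lambda>n. integral {s..t} (upper (U n))) \<longlonglongrightarrow> integral {s..t} (upper u)"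
proof -
  have sub: "{s..t} \<subseteq> {0..pi}" using st by auto
  have cn: "continuous_on {s..t} (\<lambda>x. \<bar>U n x - u x\<bar>)" for n
    by (intro continuous_intros continuous_on_subset[OF un sub] continuous_on_subset[OF u sub])
  have unif: "uniform_limit {s..t} (\<lambda>n x. \<bar>U n x - u x\<bar>) (\<lambda>x. 0) sequentially"
    using uniform_limit_on_subset[OF lim sub] by (simp add: uniform_limit_iff dist_real_def)
  obtain I J where I: "\<And>n. ((\<lambda>x. \<bar>U n x - u x\<bar>) has_integral I n) {s..t}"
    and J: "((\<lambda>x. 0) has_integral J) {s..t}" "I \<longlonglongrightarrow> J"
    by (rule uniform_limit_integral[OF unif cn sequentially_bot]) (rule that)
  have "J = 0" using has_integral_unique[OF J(1) has_integral_0] .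
  then have "(\<lambda>n. 2 * B * I n) \<longlonglongrightarrow> 0" using tendsto_mult_right_zero[of I] J(2) by simp
  have "(\<lambda>n. integral {s..t} (F (U n))) \<longlonglongrightarrow> integral {s..t} (F u)"
    if F: "\<And>u w x. \<bar>F u x - F w x\<bar> \<le> 2 * B * \<bar>u x - w x\<bar>"
      and int: "\<And>n. F (U n) integrable_on {s..t}" "F u integrable_on {s..t}"
    for F :: "(real \<Rightarrow> real) \<Rightarrow> real \<Rightarrow> real"
  proof (rule Lim_transform_bound[THEN LIM_zero_cancel])
    show "(\<lambda>n. 2 * B * I n) \<longlonglongrightarrow> 0" by fact
    have bnd: "norm (integral {s..t} (\<lambda>x. F (U n) x - F u x)) \<le> integral {s..t} (\<lambda>x. 2 * B * \<bar>U n x - u x\<bar>)" for n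
      using I[of n] F[of "U n" _ u]
      by (intro integral_norm_bound_integral integrable_diff int integrable_on_mult_right) (auto simp: has_integral_iff)
    have "norm (integral {s..t} (F (U n)) - integral {s..t} (F u)) \<le> 2 * B * I n" for n
      using bnd[of n] I[of n] Henstock_Kurzweil_Integration.integral_diff[OF int(1)[of n] int(2)] by (simp add: has_integral_iff)
    then show "\<forall>\<^sub>F n in sequentially. norm (integral {s..t} (F (U n)) - integral {s..t} (F u)) \<le> norm (2 * B * I n)"
      by (intro always_eventually allI) (metis abs_ge_self order_trans real_norm_def)
  qed
  from this[of lower] this[of upper]
  show "(\<lambda>n. integral {s..t} (lower (U n))) \<longlonglongrightarrow> integral {s..t} (lower u)"
    "(\<lambda>n. integral {s..t} (upper (U n))) \<longlonglongrightarrow> integral {s..t} (upper u)"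
    using bounds_lipschitz bounds_integrable[OF continuous_on_subset[OF un sub]]
      bounds_integrable[OF continuous_on_subset[OF u sub]] by blast+
qed

lemma admissible_integral:
  assumes "admissible u v" "x \<in> {0..pi}"
  shows "u x = u 0 + integral {0..x} v"
proof -
  have "(v has_integral (u x - u 0)) {0..x}"
    using assms(2) by (intro fundamental_theorem_of_calculus)
      (auto simp flip: has_real_derivative_iff_has_vector_derivative intro: DERIV_subset[OF admissibleD(1)[OF assms(1)]])
  then show ?thesis by (simp add: has_integral_iff)
qed

lemma admissible_uniform_limit:
  assumes adm: "\<And>n. admissible (U n) (V n)"
    and U: "uniform_limit {0..pi} U u sequentially" and V: "uniform_limit {0..pi} V v sequentially"
  shows "admissible u v"
proof -
  have cu: "continuous_on {0..pi} u" and cv: "continuous_on {0..pi} v"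
    using uniform_limit_theorem[OF _ U] uniform_limit_theorem[OF _ V] admissibleD(2,3)[OF adm]
    by (auto intro: always_eventually)
  note limU = tendsto_uniform_limitI[OF U] and limV = tendsto_uniform_limitI[OF V]
  have eq: "u x = u 0 + integral {0..x} v" if x: "x \<in> {0..pi}" for x
  proof -
    have lim: "uniform_limit {0..x} V v sequentially"
      by (rule uniform_limit_on_subset[OF V]) (use x in auto)
    have cont: "continuous_on {0..x} (V n)" for n
      using x by (intro continuous_on_subset[OF admissibleD(3)[OF adm]]) auto
    obtain I J where I: "\<And>n. (V n has_integral I n) {0..x}" "(v has_integral J) {0..x}" "I \<longlonglongrightarrow> J"
      by (rule uniform_limit_integral[OF lim cont sequentially_bot]) (rule that)
    have "(\<lambda>n. integral {0..x} (V n)) \<longlonglongrightarrow> integral {0..x} v"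
      unfolding integral_unique[OF I(1)] integral_unique[OF I(2)] by (rule I(3))
    then have "(\<lambda>n. U n 0 + integral {0..x} (V n)) \<longlonglongrightarrow> u 0 + integral {0..x} v"
      by (intro tendsto_add limU) auto
    moreover have "(\<lambda>n. U n 0 + integral {0..x} (V n)) = (\<lambda>n. U n x)"
      using admissible_integral[OF adm x] by simp
    ultimately show ?thesis
      using limU[OF x] by (metis LIMSEQ_unique)
  qed
  show ?thesis
    unfolding admissible_def
  proof (intro conjI ballI allI impI)
    fix x assume x: "x \<in> {0..pi}"
    have "((\<lambda>x. u 0 + integral {0..x} v) has_real_derivative v x) (at x within {0..pi})"
      using integral_has_real_derivative[OF cv x] by (auto intro!: derivative_eq_intros)
    then show "(u has_real_derivative v x) (at x within {0..pi})"
      by (rule has_field_derivative_transform_within[OF _ zero_less_one x]) (simp add: eq[symmetric])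
  next
    fix s t :: real assume st: "0 \<le> s" "s \<le> t" "t \<le> pi"
    have V_lim: "(\<lambda>n. V n s - V n t) \<longlonglongrightarrow> v s - v t"
      using st by (intro tendsto_diff limV) auto
    note tends = bounds_integral_tendsto[OF st(1,3) admissibleD(2)[OF adm] cu U]
    show "integral {s..t} (lower u) \<le> v s - v t"
      using admissibleD(4)[OF adm st] by (intro LIMSEQ_le[OF tends(1) V_lim]) auto
    show "v s - v t \<le> integral {s..t} (upper u)"
      using admissibleD(5)[OF adm st] by (intro LIMSEQ_le[OF V_lim tends(2)]) auto
  qed (rule cv)
qed

text \<open>A bound for the pair is a Lipschitz bound for it, uniformly over all admissible pairs.\<close>

lemma admissible_equicontinuous:
  assumes uv: "admissible u v" and bound: "\<And>x. x \<in> {0..pi} \<Longrightarrow> \<bar>u x\<bar> + \<bar>v x\<bar> \<le> G"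
    and xy: "x \<in> {0..pi}" "y \<in> {0..pi}"
  shows "norm ((u x, v x) - (u y, v y)) \<le> (1 + B) * G * \<bar>x - y\<bar>"
proof -
  have *: "norm ((u t, v t) - (u s, v s)) \<le> (1 + B) * G * (t - s)" if st: "0 \<le> s" "s \<le> t" "t \<le> pi" for s t
  proof -
    have sub: "{s..t} \<subseteq> {0..pi}" using st by auto
    note cu = continuous_on_subset[OF admissibleD(2)[OF uv] sub]
    note cv = continuous_on_subset[OF admissibleD(3)[OF uv] sub]
    have G: "\<bar>u x\<bar> \<le> G" "\<bar>v x\<bar> \<le> G" if "x \<in> {s..t}" for x
      using bound[OF subsetD[OF sub that]] by linarith+
    have "(v has_integral (u t - u s)) {s..t}"
      using st by (intro fundamental_theorem_of_calculus)
        (auto simp flip: has_real_derivative_iff_has_vector_derivative intro: DERIV_subset[OF admissibleD(1)[OF uv]])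
    then have "u t - u s = integral {s..t} v" by (simp add: has_integral_iff)
    then have 1: "\<bar>u t - u s\<bar> \<le> G * (t - s)"
      using integral_bound[of s t v G] cv st G by auto
    have "continuous_on {s..t} (\<lambda>x. \<bar>u x\<bar>)" by (intro continuous_intros cu)
    then have "integral {s..t} (\<lambda>x. \<bar>u x\<bar>) \<le> G * (t - s)"
      using integral_bound[of s t "\<lambda>x. \<bar>u x\<bar>" G] st G by auto
    then have "B * integral {s..t} (\<lambda>x. \<bar>u x\<bar>) \<le> B * (G * (t - s))"
      using B_pos by (intro mult_left_mono) auto
    then have 2: "\<bar>v t - v s\<bar> \<le> B * (G * (t - s))"
      using admissible_lipschitz[OF uv st] by simp
    have "norm ((u t, v t) - (u s, v s)) \<le> \<bar>u t - u s\<bar> + \<bar>v t - v s\<bar>"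
      using norm_Pair_le[of "u t - u s" "v t - v s"] by simp
    with 1 2 show ?thesis by (simp add: algebra_simps)
  qed
  show ?thesis
    using *[of x y] *[of y x] xy norm_minus_commute[of "(u x, v x)" "(u y, v y)"] by (cases "x \<le> y") auto
qed

text \<open>Otherwise there are admissible pairs of initial size \<open>1\<close> whose defects tend to zero. A
  subsequence converges uniformly to an admissible periodic pair of initial size \<open>1\<close>, contrary to
  uniqueness.\<close>

theorem periodicity_defect_bound:
  obtains c where "0 < c"
    "\<And>u v. admissible u v \<Longrightarrow> c * (\<bar>u 0\<bar> + \<bar>v 0\<bar>) \<le> \<bar>u pi - u 0\<bar> + \<bar>v pi - v 0\<bar>"
proof (rule ccontr)
  assume no_c: "\<not> thesis"
  have "\<exists>u v. admissible u v \<and> \<bar>u 0\<bar> + \<bar>v 0\<bar> = 1 \<and> \<bar>u pi - u 0\<bar> + \<bar>v pi - v 0\<bar> < inverse (real (Suc n))" for n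
  proof -
    define c where "c = inverse (real (Suc n))"
    have "c > 0" by (simp add: c_def)
    have "\<exists>u v. admissible u v \<and> \<bar>u pi - u 0\<bar> + \<bar>v pi - v 0\<bar> < c * (\<bar>u 0\<bar> + \<bar>v 0\<bar>)"
    proof (rule ccontr)
      assume none: "\<not> ?thesis"
      have "c * (\<bar>u 0\<bar> + \<bar>v 0\<bar>) \<le> \<bar>u pi - u 0\<bar> + \<bar>v pi - v 0\<bar>" if "admissible u v" for u v
        using none that by (meson not_le)
      from that[OF \<open>c > 0\<close> this] no_c show False by simp
    qed
    then obtain u v where uv: "admissible u v"
      and less: "\<bar>u pi - u 0\<bar> + \<bar>v pi - v 0\<bar> < c * (\<bar>u 0\<bar> + \<bar>v 0\<bar>)" by blast
    define r where "r = \<bar>u 0\<bar> + \<bar>v 0\<bar>"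
    have "0 < c * r" using less unfolding r_def by (smt (verit) abs_ge_zero)
    then have "r > 0" using \<open>c > 0\<close> by (simp add: zero_less_mult_iff)
    define u' v' where "u' = (\<lambda>x. inverse r * u x)" and "v' = (\<lambda>x. inverse r * v x)"
    have "admissible u' v'"
      unfolding u'_def v'_def using \<open>r > 0\<close> by (intro admissible_scale uv) simp
    moreover have "\<bar>u' 0\<bar> + \<bar>v' 0\<bar> = 1"
      using \<open>r > 0\<close> by (simp add: u'_def v'_def abs_mult r_def flip: distrib_left)
    moreover have "\<bar>u' pi - u' 0\<bar> + \<bar>v' pi - v' 0\<bar> < c"
    proof -
      have "\<bar>u' pi - u' 0\<bar> + \<bar>v' pi - v' 0\<bar> = inverse r * (\<bar>u pi - u 0\<bar> + \<bar>v pi - v 0\<bar>)"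
        using \<open>r > 0\<close> by (simp add: u'_def v'_def abs_mult distrib_left flip: right_diff_distrib)
      also have "\<dots> < inverse r * (c * r)"
        using less \<open>r > 0\<close> by (intro mult_strict_left_mono) (auto simp: r_def)
      also have "inverse r * (c * r) = c" using \<open>r > 0\<close> by simp
      finally show ?thesis .
    qed
    ultimately show ?thesis unfolding c_def by blast
  qed
  then obtain U V where adm: "\<And>n. admissible (U n) (V n)"
    and one: "\<And>n. \<bar>U n 0\<bar> + \<bar>V n 0\<bar> = 1"
    and defect: "\<And>n. \<bar>U n pi - U n 0\<bar> + \<bar>V n pi - V n 0\<bar> < inverse (real (Suc n))"
    by metis
  have bound: "\<bar>U n x\<bar> + \<bar>V n x\<bar> \<le> growth" if "x \<in> {0..pi}" for n x
    using admissible_gronwall[OF adm _ that, of 0 n] one[of n] by simp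
  have "growth > 0" by (simp add: growth_def)
  obtain g :: "real \<Rightarrow> real \<times> real" and \<rho> :: "nat \<Rightarrow> nat" where "strict_mono \<rho>"
    and g: "\<And>e. 0 < e \<Longrightarrow> \<exists>N. \<forall>n x. n \<ge> N \<and> x \<in> {0..pi} \<longrightarrow> norm ((U (\<rho> n) x, V (\<rho> n) x) - g x) < e"
  proof (rule Arzela_Ascoli[of "{0..pi}" "\<lambda>n x. (U n x, V n x)" growth])
    show "compact {0..pi}" by simp
    show "norm (U n x, V n x) \<le> growth" if "x \<in> {0..pi}" for n x
      using norm_Pair_le[of "U n x" "V n x"] bound[OF that, of n] by simp
    show "\<exists>d>0. \<forall>n y. y \<in> {0..pi} \<and> norm (x - y) < d \<longrightarrow> norm ((U n x, V n x) - (U n y, V n y)) < e"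
      if x: "x \<in> {0..pi}" and e: "0 < e" for x e
    proof (intro exI conjI allI impI; (elim conjE)?)
      have pos: "(1 + B) * growth > 0" using B_pos \<open>growth > 0\<close> by simp
      then show "e / ((1 + B) * growth) > 0" using e by simp
      fix n y assume "y \<in> {0..pi}" "norm (x - y) < e / ((1 + B) * growth)"
      then have "(1 + B) * growth * \<bar>x - y\<bar> < e"
        using pos by (simp add: pos_less_divide_eq mult.commute)
      then show "norm ((U n x, V n x) - (U n y, V n y)) < e"
        using admissible_equicontinuous[OF adm bound x \<open>y \<in> {0..pi}\<close>, of n] by simp
    qed
  qed (use that in blast)
  define u v where "u = (\<lambda>x. fst (g x))" and "v = (\<lambda>x. snd (g x))"
  have ulim: "uniform_limit {0..pi} (\<lambda>n. U (\<rho> n)) u sequentially"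
    and vlim: "uniform_limit {0..pi} (\<lambda>n. V (\<rho> n)) v sequentially"
  proof -
    have *: "\<bar>U n x - u x\<bar> \<le> norm ((U n x, V n x) - g x)" "\<bar>V n x - v x\<bar> \<le> norm ((U n x, V n x) - g x)" for n x
      using norm_fst_le[of "fst ((U n x, V n x) - g x)" "snd ((U n x, V n x) - g x)"]
        norm_snd_le[of "snd ((U n x, V n x) - g x)" "fst ((U n x, V n x) - g x)"]
      by (cases "g x"; simp add: u_def v_def)+
    show "uniform_limit {0..pi} (\<lambda>n. U (\<rho> n)) u sequentially" "uniform_limit {0..pi} (\<lambda>n. V (\<rho> n)) v sequentially"
      unfolding uniform_limit_iff eventually_sequentially dist_real_def
      using g * by (meson le_less_trans)+
  qed
  have uv: "admissible u v"
    by (rule admissible_uniform_limit[OF _ ulim vlim]) (rule adm)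
  have lim: "(\<lambda>n. U (\<rho> n) x) \<longlonglongrightarrow> u x" "(\<lambda>n. V (\<rho> n) x) \<longlonglongrightarrow> v x" if "x \<in> {0..pi}" for x
    using tendsto_uniform_limitI[OF ulim that] tendsto_uniform_limitI[OF vlim that] .
  have "(\<lambda>n. \<bar>U (\<rho> n) pi - U (\<rho> n) 0\<bar> + \<bar>V (\<rho> n) pi - V (\<rho> n) 0\<bar>) \<longlonglongrightarrow> \<bar>u pi - u 0\<bar> + \<bar>v pi - v 0\<bar>"
    by (intro tendsto_intros lim) auto
  moreover have "(\<lambda>n. \<bar>U (\<rho> n) pi - U (\<rho> n) 0\<bar> + \<bar>V (\<rho> n) pi - V (\<rho> n) 0\<bar>) \<longlonglongrightarrow> 0"
  proof (rule tendsto_sandwich[OF _ _ tendsto_const LIMSEQ_inverse_real_of_nat])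
    show "\<forall>\<^sub>F n in sequentially. \<bar>U (\<rho> n) pi - U (\<rho> n) 0\<bar> + \<bar>V (\<rho> n) pi - V (\<rho> n) 0\<bar> \<le> inverse (real (Suc n))"
    proof (rule always_eventually, rule allI)
      fix n
      have "inverse (real (Suc (\<rho> n))) \<le> inverse (real (Suc n))"
        using seq_suble[OF \<open>strict_mono \<rho>\<close>, of n] by (intro le_imp_inverse_le) auto
      from less_imp_le[OF less_le_trans[OF defect[of "\<rho> n"] this]] show "\<bar>U (\<rho> n) pi - U (\<rho> n) 0\<bar> + \<bar>V (\<rho> n) pi - V (\<rho> n) 0\<bar> \<le> inverse (real (Suc n))" .
    qed
  qed (simp add: always_eventually)
  ultimately have "\<bar>u pi - u 0\<bar> + \<bar>v pi - v 0\<bar> = 0"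
    by (rule LIMSEQ_unique)
  then have per: "u 0 = u pi" "v 0 = v pi" by auto
  have zero: "u x = 0" if "x \<in> {0..pi}" for x
    by (rule periodic_admissible_zero[OF uv per that])
  have "v 0 = 0"
  proof -
    have "(u has_real_derivative v 0) (at 0 within {0..pi})"
      by (rule admissibleD(1)[OF uv]) simp
    moreover have "(u has_real_derivative 0) (at 0 within {0..pi})"
      by (rule has_field_derivative_transform_within[OF DERIV_const[of 0], of 1]) (use zero in auto)
    moreover have "at (0::real) within {0..pi} \<noteq> bot"
      by (simp add: at_within_Icc_at_right)
    ultimately show ?thesis
      by (metis has_field_derivative_unique)
  qed
  have "(\<lambda>n. \<bar>U (\<rho> n) 0\<bar> + \<bar>V (\<rho> n) 0\<bar>) \<longlonglongrightarrow> \<bar>u 0\<bar> + \<bar>v 0\<bar>"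
    by (intro tendsto_intros lim) auto
  then have "(\<lambda>n::nat. 1) \<longlonglongrightarrow> \<bar>u 0\<bar> + \<bar>v 0\<bar>" by (simp add: one)
  then have "\<bar>u 0\<bar> + \<bar>v 0\<bar> = 1" by (metis LIMSEQ_unique tendsto_const)
  with zero[of 0] \<open>v 0 = 0\<close> show False by simp
qed

end

section \<open>Shooting for the nonlinear equation\<close>

text \<open>The range is open by invariance of domain. It is closed because a sequence whose images converge is
  itself a Cauchy sequence.\<close>

lemma continuous_expanding_surj:
  fixes f :: "'a::euclidean_space \<Rightarrow> 'a"
  assumes cont: "continuous_on UNIV f" and "0 < c"
    and expand: "\<And>x y. c * dist x y \<le> dist (f x) (f y)"
  shows "surj f"
proof -
  have "inj f"
  proof (rule injI)
    fix x y assume "f x = f y"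
    with expand[of x y] \<open>0 < c\<close> show "x = y" by (simp add: mult_le_0_iff)
  qed
  then have "open (range f)"
    using invariance_of_domain[OF cont open_UNIV] by simp
  moreover have "closed (range f)"
    unfolding closed_sequential_limits
  proof (intro allI impI, elim conjE)
    fix X y assume X: "\<forall>n. X n \<in> range f" and lim: "X \<longlonglongrightarrow> y"
    have "\<forall>n. \<exists>z. X n = f z" using X by blast
    then obtain z where z: "\<And>n. X n = f (z n)" by metis
    have "Cauchy z"
    proof (rule metric_CauchyI)
      fix e :: real assume "e > 0"
      then have "c * e > 0" using \<open>0 < c\<close> by simp
      then obtain M where M: "\<forall>m\<ge>M. \<forall>n\<ge>M. dist (X m) (X n) < c * e"
        using metric_CauchyD[OF LIMSEQ_imp_Cauchy[OF lim]] by blast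
      have "dist (z m) (z n) < e" if "m \<ge> M" "n \<ge> M" for m n
      proof -
        have "c * dist (z m) (z n) < c * e"
          using expand[of "z m" "z n"] M that z by (metis le_less_trans)
        then show ?thesis using \<open>0 < c\<close> by simp
      qed
      then show "\<exists>M. \<forall>m\<ge>M. \<forall>n\<ge>M. dist (z m) (z n) < e" by blast
    qed
    then obtain z0 where "z \<longlonglongrightarrow> z0" using Cauchy_convergent_iff convergent_def by blast
    then have "(\<lambda>n. f (z n)) \<longlonglongrightarrow> f z0"
      using continuous_on_tendsto_compose[OF cont] by simp
    then have "X \<longlonglongrightarrow> f z0" using z by presburger
    then have "y = f z0" using lim LIMSEQ_unique by blast
    then show "y \<in> range f" by blast
  qed
  ultimately show ?thesis using clopen[of "range f"] by auto
qed

text \<open>The slope conditions are required for every \<open>x\<close>, which spares all null sets until the end.\<close>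

locale monotone_nonlinearity = two_step_bound +
  fixes g :: "real \<Rightarrow> real \<Rightarrow> real"
  assumes g_measurable: "\<And>w. (\<lambda>x. g x w) \<in> borel_measurable lebesgue"
    and g_slope_ge: "\<And>x p q. q \<le> p \<Longrightarrow> a x * (p - q) \<le> g x p - g x q"
    and g_slope_le: "\<And>x p q. q \<le> p \<Longrightarrow> g x p - g x q \<le> k x * (p - q)"
    and g_0_integrable: "(\<lambda>x. g x 0) absolutely_integrable_on {0..pi}"
begin

lemma g_lipschitz: "\<bar>g x p - g x q\<bar> \<le> B * \<bar>p - q\<bar>"
proof -
  have *: "\<bar>g x p - g x q\<bar> \<le> B * \<bar>p - q\<bar>" if "q \<le> p" for p q
  proof -
    have "0 \<le> a x * (p - q)" "k x * (p - q) \<le> B * (p - q)"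
      using a_nonneg[of x] k_bounds(2)[of x] that by (auto intro: mult_right_mono)
    with g_slope_ge[OF that, of x] g_slope_le[OF that, of x] that show ?thesis by simp
  qed
  show ?thesis using *[of q p] *[of p q] by (cases "q \<le> p") (simp_all add: abs_minus_commute)
qed

text \<open>Round \<open>u\<close> down to multiples of \<open>1 / (n + 1)\<close>. This gives functions with countably many values, for which
  measurability of the superposition is clear, and \<open>g x\<close> is continuous.\<close>

lemma g_superposition_measurable:
  assumes u: "u \<in> borel_measurable (lebesgue_on S)"
  shows "(\<lambda>x. g x (u x)) \<in> borel_measurable (lebesgue_on S)"
proof (rule borel_measurable_LIMSEQ_real)
  define q where "q = (\<lambda>n x. real_of_int \<lfloor>real (Suc n) * u x\<rfloor> / real (Suc n))"
  show "(\<lambda>x. g x (q n x)) \<in> borel_measurable (lebesgue_on S)" for n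
    unfolding q_def
  proof (rule measurable_compose_countable[where f="\<lambda>i x. g x (real_of_int i / real (Suc n))"])
    show "(\<lambda>x. g x (real_of_int i / real (Suc n))) \<in> borel_measurable (lebesgue_on S)" for i
      by (rule measurable_restrict_space1[OF g_measurable])
    show "(\<lambda>x. \<lfloor>real (Suc n) * u x\<rfloor>) \<in> measurable (lebesgue_on S) (count_space UNIV)"
      using u by measurable
  qed
  fix x
  have close: "\<bar>q n x - u x\<bar> \<le> inverse (real (Suc n))" for n
  proof -
    have "\<bar>real_of_int \<lfloor>real (Suc n) * u x\<rfloor> - real (Suc n) * u x\<bar> \<le> 1"
      by linarith
    moreover have "q n x - u x = (real_of_int \<lfloor>real (Suc n) * u x\<rfloor> - real (Suc n) * u x) / real (Suc n)"
      by (simp add: q_def field_simps)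
    ultimately show ?thesis by (simp add: divide_right_mono inverse_eq_divide)
  qed
  have "(\<lambda>n. g x (q n x) - g x (u x)) \<longlonglongrightarrow> 0"
  proof (rule Lim_null_comparison)
    show "\<forall>\<^sub>F n in sequentially. norm (g x (q n x) - g x (u x)) \<le> B * inverse (real (Suc n))"
    proof (rule always_eventually, rule allI)
      fix n
      have "norm (g x (q n x) - g x (u x)) \<le> B * \<bar>q n x - u x\<bar>" using g_lipschitz by simp
      also have "\<dots> \<le> B * inverse (real (Suc n))" using close B_pos by (intro mult_left_mono) auto
      finally show "norm (g x (q n x) - g x (u x)) \<le> B * inverse (real (Suc n))" .
    qed
    show "(\<lambda>n. B * inverse (real (Suc n))) \<longlonglongrightarrow> 0"
      using tendsto_mult_right_zero[OF LIMSEQ_inverse_real_of_nat] by simp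
  qed
  then show "(\<lambda>n. g x (q n x)) \<longlonglongrightarrow> g x (u x)" by (rule LIM_zero_cancel)
qed

lemma g_superposition_integrable:
  assumes u: "continuous_on {s..t} u" and st: "0 \<le> s" "t \<le> pi"
  shows "(\<lambda>x. g x (u x)) absolutely_integrable_on {s..t}"
proof (rule measurable_bounded_by_integrable_imp_absolutely_integrable)
  have "u \<in> borel_measurable (lebesgue_on {s..t})"
    using u by (rule continuous_imp_measurable_on_sets_lebesgue) simp
  then show "(\<lambda>x. g x (u x)) \<in> borel_measurable (lebesgue_on {s..t})"
    by (rule g_superposition_measurable)
  have "(\<lambda>x. \<bar>g x 0\<bar>) integrable_on {0..pi}"
    using g_0_integrable by (auto simp: absolutely_integrable_on_def)
  then have i0: "(\<lambda>x. \<bar>g x 0\<bar>) integrable_on {s..t}"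
    by (rule integrable_on_subinterval) (use st in auto)
  show "(\<lambda>x. \<bar>g x 0\<bar> + B * \<bar>u x\<bar>) integrable_on {s..t}"
    by (rule integrable_add[OF i0]) (intro integrable_continuous_real continuous_intros u)
  show "norm (g x (u x)) \<le> \<bar>g x 0\<bar> + B * \<bar>u x\<bar>" for x
    using g_lipschitz[of x "u x" 0] by simp
qed simp

lemma g_superposition_integrable_on:
  assumes "continuous_on {0..pi} u" "0 \<le> s" "t \<le> pi"
  shows "(\<lambda>x. g x (u x)) integrable_on {s..t}"
proof -
  have "continuous_on {s..t} u" using assms by (auto intro: continuous_on_subset)
  from g_superposition_integrable[OF this assms(2,3)] show ?thesis
    by (rule set_lebesgue_integral_eq_integral(1))
qed

text \<open>Solutions of the integrated equation.\<close>

definition trajectory :: "(real \<Rightarrow> real) \<Rightarrow> (real \<Rightarrow> real) \<Rightarrow> bool" where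
  "trajectory u v \<longleftrightarrow>
     (\<forall>x\<in>{0..pi}. (u has_real_derivative v x) (at x within {0..pi})) \<and>
     continuous_on {0..pi} v \<and>
     (\<forall>s t. 0 \<le> s \<longrightarrow> s \<le> t \<longrightarrow> t \<le> pi \<longrightarrow> v s - v t = integral {s..t} (\<lambda>x. g x (u x)))"

lemma trajectoryD:
  assumes "trajectory u v"
  shows "\<And>x. x \<in> {0..pi} \<Longrightarrow> (u has_real_derivative v x) (at x within {0..pi})"
    and "continuous_on {0..pi} u" and "continuous_on {0..pi} v"
    and "\<And>s t. 0 \<le> s \<Longrightarrow> s \<le> t \<Longrightarrow> t \<le> pi \<Longrightarrow> v s - v t = integral {s..t} (\<lambda>x. g x (u x))"
  using assms unfolding trajectory_def by (auto intro: DERIV_continuous_on)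

lemma trajectory_diff_admissible:
  assumes 1: "trajectory u1 v1" and 2: "trajectory u2 v2"
  shows "admissible (\<lambda>x. u1 x - u2 x) (\<lambda>x. v1 x - v2 x)"
  unfolding admissible_def
proof (intro conjI ballI allI impI)
  fix s t :: real assume st: "0 \<le> s" "s \<le> t" "t \<le> pi"
  define w where "w = (\<lambda>x. u1 x - u2 x)"
  have cw: "continuous_on {s..t} w"
    unfolding w_def using st
    by (intro continuous_intros continuous_on_subset[OF trajectoryD(2)[OF 1]] continuous_on_subset[OF trajectoryD(2)[OF 2]]) auto
  have int: "(\<lambda>x. g x (u1 x)) integrable_on {s..t}" "(\<lambda>x. g x (u2 x)) integrable_on {s..t}"
    using st by (auto intro!: g_superposition_integrable_on trajectoryD(2) 1 2)
  have eq: "(v1 s - v2 s) - (v1 t - v2 t) = integral {s..t} (\<lambda>x. g x (u1 x) - g x (u2 x))"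
    using trajectoryD(4)[OF 1 st] trajectoryD(4)[OF 2 st]
    by (simp add: Henstock_Kurzweil_Integration.integral_diff[OF int])
  have "lower w x \<le> g x (u1 x) - g x (u2 x) \<and> g x (u1 x) - g x (u2 x) \<le> upper w x" for x
    using g_slope_ge[of "u2 x" "u1 x" x] g_slope_le[of "u2 x" "u1 x" x]
      g_slope_ge[of "u1 x" "u2 x" x] g_slope_le[of "u1 x" "u2 x" x]
    by (cases "u2 x \<le> u1 x") (auto simp: lower_def upper_def w_def max_def algebra_simps)
  then show "integral {s..t} (lower w) \<le> v1 s - v2 s - (v1 t - v2 t)"
    "v1 s - v2 s - (v1 t - v2 t) \<le> integral {s..t} (upper w)"
    unfolding eq by (intro integral_le bounds_integrable[OF cw] integrable_diff int; blast)+
qed (auto intro!: derivative_intros continuous_intros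
    trajectoryD(1)[OF 1] trajectoryD(1)[OF 2] trajectoryD(3)[OF 1] trajectoryD(3)[OF 2])

text \<open>The integral operator contracts in the norm weighted by \<open>exp (- L x)\<close>. The fixed point is sought in
  the form \<open>u x = exp (L x) * w x\<close> with \<open>w\<close> bounded and continuous on the whole line, which is
  achieved by clamping the argument to \<open>[0, \<pi>]\<close>.\<close>

lemma initial_value_problem:
  obtains u v where "trajectory u v" "u 0 = c" "v 0 = d"
proof -
  define L where "L = B + 1"
  \<comment> \<open>\<open>B / L\<^sup>2\<close> is the contraction factor: each of the two integrations of \<open>exp (L x)\<close> yields \<open>1 / L\<close>.\<close>
  have L: "L > 0" "0 \<le> B / L\<^sup>2" "B / L\<^sup>2 < 1"
    using B_pos by (auto simp: L_def power2_eq_square divide_less_eq) (simp add: algebra_simps add_pos_nonneg)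
  define V where "V = (\<lambda>w s. d - integral {0..s} (\<lambda>t. g t (exp (L * t) * w t)))"
  define U where "U = (\<lambda>w x. c + integral {0..x} (V w))"
  have scaled: "continuous_on {0..pi} (\<lambda>t. exp (L * t) * w t)" if "continuous_on {0..pi} w" for w
    by (intro continuous_intros that)
  have int_g: "(\<lambda>t. g t (exp (L * t) * w t)) integrable_on {s..t}"
    if "continuous_on {0..pi} w" "0 \<le> s" "t \<le> pi" for w s t
    by (rule g_superposition_integrable_on[OF scaled that(2,3)]) (rule that)
  have cV: "continuous_on {0..pi} (V w)" if "continuous_on {0..pi} w" for w
    unfolding V_def using int_g[OF that, of 0 pi]
    by (intro continuous_intros indefinite_integral_continuous_1) auto
  have cU: "continuous_on {0..pi} (U w)" if "continuous_on {0..pi} w" for w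
    unfolding U_def using cV[OF that]
    by (intro continuous_intros indefinite_integral_continuous_1 integrable_continuous_real)
  have "\<exists>W :: real \<Rightarrow>\<^sub>C real. \<forall>x. W x = exp (- L * clamp 0 pi x) * U w (clamp 0 pi x)"
    if "continuous_on {0..pi} w" for w
  proof -
    have "continuous_on (cbox 0 pi) (\<lambda>x. exp (- L * x) * U w x)"
      using cU[OF that] by (auto intro!: continuous_intros)
    then obtain W :: "real \<Rightarrow>\<^sub>C real" where "\<And>x. W x = exp (- L * clamp 0 pi x) * U w (clamp 0 pi x)"
      by (rule continuous_on_cbox_bcontfunE) (rule that)
    then show ?thesis by blast
  qed
  then have "\<forall>w :: real \<Rightarrow>\<^sub>C real. \<exists>W :: real \<Rightarrow>\<^sub>C real. \<forall>x. W x = exp (- L * clamp 0 pi x) * U w (clamp 0 pi x)"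
    by simp
  then obtain \<Phi> :: "(real \<Rightarrow>\<^sub>C real) \<Rightarrow> (real \<Rightarrow>\<^sub>C real)"
    where \<Phi>: "\<And>w x. \<Phi> w x = exp (- L * clamp 0 pi x) * U w (clamp 0 pi x)"
    by metis
  have contraction: "dist (\<Phi> w1) (\<Phi> w2) \<le> B / L\<^sup>2 * dist w1 w2" for w1 w2
  proof (rule dist_bound)
    fix y :: real
    define x where "x = clamp 0 pi y"
    have x: "x \<in> {0..pi}"
      using clamp_in_interval[of 0 pi y] by (auto simp: x_def)
    define \<delta> where "\<delta> = dist w1 w2"
    have "\<delta> \<ge> 0" by (simp add: \<delta>_def)
    have exp_int: "((\<lambda>t. C * exp (L * t)) has_integral C * exp (L * s) / L - C / L) {0..s}" if "0 \<le> s" for C s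
    proof -
      have "((\<lambda>t. C * exp (L * t)) has_integral C * exp (L * s) / L - C * exp (L * 0) / L) {0..s}"
        by (rule fundamental_theorem_of_calculus[OF that])
          (use L(1) in \<open>auto simp flip: has_real_derivative_iff_has_vector_derivative intro!: derivative_eq_intros\<close>)
      then show ?thesis by simp
    qed
    have exp_le: "integral {0..s} h \<le> C / L * exp (L * s)"
      if "h integrable_on {0..s}" "\<And>t. t \<in> {0..s} \<Longrightarrow> h t \<le> C * exp (L * t)" "0 \<le> s" "0 \<le> C" for h C s
    proof -
      have "integral {0..s} h \<le> C * exp (L * s) / L - C / L"
        using that(2) by (intro has_integral_le[OF integrable_integral[OF that(1)] exp_int[OF that(3)]]) auto
      moreover have "0 \<le> C / L" using that(4) L(1) by simp
      ultimately have "integral {0..s} h \<le> C * exp (L * s) / L" by linarith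
      then show ?thesis by simp
    qed
    have V_diff: "\<bar>V w1 s - V w2 s\<bar> \<le> B * \<delta> / L * exp (L * s)" if s: "s \<in> {0..x}" for s
    proof -
      have sp: "0 \<le> s" "s \<le> pi" using s x by auto
      note i1 = int_g[of w1 0 s, OF continuous_on_apply_bcontfun order_refl sp(2)]
      note i2 = int_g[of w2 0 s, OF continuous_on_apply_bcontfun order_refl sp(2)]
      have pt: "\<bar>g t (exp (L * t) * w2 t) - g t (exp (L * t) * w1 t)\<bar> \<le> (B * \<delta>) * exp (L * t)" for t
      proof -
        have "\<bar>g t (exp (L * t) * w2 t) - g t (exp (L * t) * w1 t)\<bar> \<le> B * \<bar>exp (L * t) * w2 t - exp (L * t) * w1 t\<bar>"
          by (rule g_lipschitz)
        also have "\<bar>exp (L * t) * w2 t - exp (L * t) * w1 t\<bar> = exp (L * t) * \<bar>w2 t - w1 t\<bar>"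
          by (simp add: abs_mult flip: right_diff_distrib)
        also have "\<bar>w2 t - w1 t\<bar> \<le> \<delta>"
          using dist_bounded[of w1 t w2] by (simp add: \<delta>_def dist_real_def abs_minus_commute)
        finally show ?thesis using B_pos by (simp add: algebra_simps)
      qed
      have "V w1 s - V w2 s = integral {0..s} (\<lambda>t. g t (exp (L * t) * w2 t) - g t (exp (L * t) * w1 t))"
        unfolding V_def by (simp add: Henstock_Kurzweil_Integration.integral_diff[OF i2 i1])
      moreover have "\<bar>integral {0..s} (\<lambda>t. g t (exp (L * t) * w2 t) - g t (exp (L * t) * w1 t))\<bar>
          \<le> integral {0..s} (\<lambda>t. (B * \<delta>) * exp (L * t))"
        unfolding real_norm_def[symmetric]
        by (rule integral_norm_bound_integral[OF integrable_diff[OF i2 i1]])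
          (use pt in \<open>auto intro!: integrable_continuous_real continuous_intros\<close>)
      moreover have "\<dots> \<le> B * \<delta> / L * exp (L * s)"
        using sp \<open>\<delta> \<ge> 0\<close> B_pos by (intro exp_le integrable_continuous_real continuous_intros) auto
      ultimately show ?thesis by simp
    qed
    have iV: "V w integrable_on {0..x}" for w :: "real \<Rightarrow>\<^sub>C real"
      using x by (intro integrable_continuous_real continuous_on_subset[OF cV[OF continuous_on_apply_bcontfun]]) auto
    have "U w1 x - U w2 x = integral {0..x} (\<lambda>s. V w1 s - V w2 s)"
      unfolding U_def by (simp add: Henstock_Kurzweil_Integration.integral_diff[OF iV iV])
    moreover have "\<bar>integral {0..x} (\<lambda>s. V w1 s - V w2 s)\<bar> \<le> integral {0..x} (\<lambda>s. B * \<delta> / L * exp (L * s))"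
      unfolding real_norm_def[symmetric]
      by (rule integral_norm_bound_integral[OF integrable_diff[OF iV iV]])
        (use V_diff L(1) in \<open>auto intro!: integrable_continuous_real continuous_intros\<close>)
    moreover have "\<dots> \<le> B * \<delta> / L / L * exp (L * x)"
      using x \<open>\<delta> \<ge> 0\<close> B_pos L(1) by (intro exp_le integrable_continuous_real continuous_intros) auto
    ultimately have "\<bar>U w1 x - U w2 x\<bar> \<le> B / L\<^sup>2 * \<delta> * exp (L * x)"
      by (simp add: power2_eq_square)
    then have "exp (- L * x) * \<bar>U w1 x - U w2 x\<bar> \<le> exp (- L * x) * (B / L\<^sup>2 * \<delta> * exp (L * x))"
      by (rule mult_left_mono) simp
    also have "\<dots> = B / L\<^sup>2 * \<delta>" by (simp add: exp_minus)
    finally show "dist (\<Phi> w1 y) (\<Phi> w2 y) \<le> B / L\<^sup>2 * dist w1 w2"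
      by (simp add: \<Phi> dist_real_def \<delta>_def abs_mult flip: right_diff_distrib x_def)
  qed
  obtain w where w: "\<Phi> w = w"
    using banach_fix_type[OF L(2,3), of \<Phi>] contraction by blast
  define u where "u = U w"
  define v where "v = V w"
  have cw: "continuous_on {0..pi} (apply_bcontfun w)" by simp
  have fixed: "exp (L * x) * w x = u x" if "x \<in> {0..pi}" for x
  proof -
    have "clamp 0 pi x = x" using that by (intro clamp_cancel_cbox) auto
    then have "w x = exp (- L * x) * u x" using \<Phi>[of w x] w by (simp add: u_def)
    then show ?thesis by (simp add: exp_minus)
  qed
  have "trajectory u v"
    unfolding trajectory_def
  proof (intro conjI ballI allI impI)
    fix x assume x: "x \<in> {0..pi}"
    show "(u has_real_derivative v x) (at x within {0..pi})"
      unfolding u_def U_def v_def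
      using integral_has_real_derivative[OF cV[OF cw] x] by (auto intro!: derivative_eq_intros)
  next
    show "continuous_on {0..pi} v" unfolding v_def by (rule cV[OF cw])
  next
    fix s t :: real assume st: "0 \<le> s" "s \<le> t" "t \<le> pi"
    have "v s - v t = integral {s..t} (\<lambda>x. g x (exp (L * x) * w x))"
      using Henstock_Kurzweil_Integration.integral_combine[OF st(1,2) int_g[OF cw order_refl st(3)]]
      by (simp add: v_def V_def)
    also have "\<dots> = integral {s..t} (\<lambda>x. g x (u x))"
      using st fixed by (intro integral_cong) auto
    finally show "v s - v t = integral {s..t} (\<lambda>x. g x (u x))" .
  qed
  moreover have "u 0 = c" "v 0 = d" by (simp_all add: u_def U_def v_def V_def)
  ultimately show thesis by (rule that)
qed

text \<open>The shooting map \<open>P\<close> sends initial data to the defect of their trajectory. The difference of two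
  trajectories is admissible, so \<open>periodicity_defect_bound\<close> makes \<open>P\<close> expanding and the
  Gronwall inequality makes it Lipschitz.\<close>

theorem periodic_trajectory_exists:
  obtains u v where "trajectory u v" "u 0 = u pi" "v 0 = v pi"
proof -
  have "\<forall>z :: real \<times> real. \<exists>uv. trajectory (fst uv) (snd uv) \<and> fst uv 0 = fst z \<and> snd uv 0 = snd z"
    by (metis initial_value_problem fst_conv snd_conv)
  then obtain S where S: "\<And>z :: real \<times> real. trajectory (fst (S z)) (snd (S z))"
    and init: "\<And>z. fst (S z) 0 = fst z" "\<And>z. snd (S z) 0 = snd z" by metis
  define P where "P = (\<lambda>z. (fst (S z) pi - fst z, snd (S z) pi - snd z))"
  obtain c where "0 < c" and c: "\<And>u v. admissible u v \<Longrightarrow> c * (\<bar>u 0\<bar> + \<bar>v 0\<bar>) \<le> \<bar>u pi - u 0\<bar> + \<bar>v pi - v 0\<bar>"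
    by (rule periodicity_defect_bound) (blast intro: that)
  have l1: "norm z \<le> \<bar>fst z\<bar> + \<bar>snd z\<bar>" "\<bar>fst z\<bar> + \<bar>snd z\<bar> \<le> 2 * norm z" for z :: "real \<times> real"
    using norm_Pair_le[of "fst z" "snd z"] norm_fst_le[of "fst z" "snd z"] norm_snd_le[of "snd z" "fst z"] by auto
  have "surj P"
  proof (rule continuous_expanding_surj)
    show "0 < c / 2" using \<open>0 < c\<close> by simp
    fix z z' :: "real \<times> real"
    note adm = trajectory_diff_admissible[OF S S, of z z']
    have "c * (\<bar>fst (z - z')\<bar> + \<bar>snd (z - z')\<bar>) \<le> \<bar>fst (P z - P z')\<bar> + \<bar>snd (P z - P z')\<bar>"
      using c[OF adm] by (simp add: P_def init algebra_simps)
    moreover have "c * norm (z - z') \<le> c * (\<bar>fst (z - z')\<bar> + \<bar>snd (z - z')\<bar>)"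
      using l1(1)[of "z - z'"] \<open>0 < c\<close> by simp
    ultimately show "c / 2 * dist z z' \<le> dist (P z) (P z')"
      using l1(2)[of "P z - P z'"] by (simp add: dist_norm)
  next
    have lip: "dist (P z) (P z') \<le> 2 * (growth + 1) * dist z z'" for z z'
    proof -
      note adm = trajectory_diff_admissible[OF S S, of z z']
      define D where "D = \<bar>fst (z - z')\<bar> + \<bar>snd (z - z')\<bar>"
      have "\<bar>fst (S z) pi - fst (S z') pi\<bar> + \<bar>snd (S z) pi - snd (S z') pi\<bar> \<le> growth * D"
        using admissible_gronwall[OF adm, of 0 pi] by (simp add: init D_def)
      moreover have "fst (P z - P z') = (fst (S z) pi - fst (S z') pi) - fst (z - z')"
        "snd (P z - P z') = (snd (S z) pi - snd (S z') pi) - snd (z - z')"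
        by (simp_all add: P_def)
      ultimately have "\<bar>fst (P z - P z')\<bar> + \<bar>snd (P z - P z')\<bar> \<le> growth * D + D"
        unfolding D_def by linarith
      also have "\<dots> = (growth + 1) * D" by (simp add: algebra_simps)
      also have "\<dots> \<le> (growth + 1) * (2 * norm (z - z'))"
        using l1(2)[of "z - z'"] by (intro mult_left_mono) (auto simp: D_def growth_def add_nonneg_nonneg)
      also have "\<dots> = 2 * (growth + 1) * dist z z'" by (simp add: dist_norm)
      finally show ?thesis using l1(1)[of "P z - P z'"] unfolding dist_norm by linarith
    qed
    show "continuous_on UNIV P"
    proof (rule continuous_onI)
      fix z :: "real \<times> real" and e :: real assume "0 < e"
      have K: "0 < 2 * (growth + 1)" by (simp add: growth_def add_pos_pos)
      show "\<exists>d>0. \<forall>z'\<in>UNIV. dist z' z < d \<longrightarrow> dist (P z') (P z) \<le> e"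
      proof (intro exI conjI ballI impI)
        show "0 < e / (2 * (growth + 1))" using K \<open>0 < e\<close> by simp
        fix z' assume "dist z' z < e / (2 * (growth + 1))"
        then have "2 * (growth + 1) * dist z' z < e" using K by (simp add: pos_less_divide_eq mult.commute)
        with lip[of z' z] show "dist (P z') (P z) \<le> e" by simp
      qed
    qed
  qed
  then obtain z where "P z = 0" by (metis surjD)
  then have "fst (S z) 0 = fst (S z) pi" "snd (S z) 0 = snd (S z) pi"
    by (simp_all add: P_def init prod_eq_iff)
  with S[of z] show thesis by (rule that)
qed

theorem periodic_trajectory_unique:
  assumes "trajectory u1 v1" "u1 0 = u1 pi" "v1 0 = v1 pi"
    and "trajectory u2 v2" "u2 0 = u2 pi" "v2 0 = v2 pi" and "x \<in> {0..pi}"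
  shows "u1 x = u2 x"
  using periodic_admissible_zero[OF trajectory_diff_admissible[OF assms(1,4)] _ _ assms(7)] assms by simp

subsection \<open>Comparison with solutions in the sense of Caratheodory\<close>

lemma trajectory_imp_periodic_solution:
  assumes uv: "trajectory u v" and per: "u 0 = u pi" "v 0 = v pi"
    and f: "negligible N" "\<And>x w. x \<in> {0<..<pi} - N \<Longrightarrow> f x w = g x w"
  shows "periodic_solution f u"
proof -
  define h where "h = (\<lambda>x. - g x (u x))"
  have h: "h absolutely_integrable_on {0..pi}"
    using set_integrable_mult_right[OF g_superposition_integrable[OF trajectoryD(2)[OF uv] order_refl order_refl], of "-1"]
    by (simp add: h_def)
  have v: "v t - v s = integral {s..t} h" if "0 \<le> s" "s \<le> t" "t \<le> pi" for s t
    using trajectoryD(4)[OF uv that] by (simp add: h_def)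
  obtain M where M: "negligible M" "\<And>x. x \<in> {0<..<pi} - M \<Longrightarrow> (v has_real_derivative h x) (at x)"
    by (rule indefinite_integral_has_derivative_ae[OF set_lebesgue_integral_eq_integral(1)[OF h] v]) (blast intro: that)+
  have "AE x in lebesgue_on {0<..<pi}. \<exists>u2. (v has_real_derivative u2) (at x) \<and> u2 + f x (u x) = 0"
  proof (subst AE_lebesgue_on_iff_negligible)
    show "negligible {x \<in> {0<..<pi}. \<not> (\<exists>u2. (v has_real_derivative u2) (at x) \<and> u2 + f x (u x) = 0)}"
    proof (rule negligible_subset[OF negligible_Un[OF M(1) f(1)]], rule subsetI, rule ccontr)
      fix x assume "x \<in> {x \<in> {0<..<pi}. \<not> (\<exists>u2. (v has_real_derivative u2) (at x) \<and> u2 + f x (u x) = 0)}"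
        and "x \<notin> M \<union> N"
      then show False using M(2)[of x] f(2)[of x "u x"] by (auto simp: h_def)
    qed
  qed simp
  moreover have "abs_cont_on 0 pi v"
    by (rule abs_cont_on_indefinite_integral[OF h v])
  ultimately show ?thesis
    unfolding periodic_solution_def using trajectoryD(1,3)[OF uv] per by (intro exI[of _ v]) auto
qed

lemma periodic_solution_imp_trajectory:
  assumes sol: "periodic_solution f u"
    and f: "negligible N" "\<And>x w. x \<in> {0<..<pi} - N \<Longrightarrow> f x w = g x w"
  obtains v where "trajectory u v" "u 0 = u pi" "v 0 = v pi"
proof -
  obtain v where u: "\<And>x. x \<in> {0..pi} \<Longrightarrow> (u has_real_derivative v x) (at x within {0..pi})"
    and v: "continuous_on {0..pi} v" "abs_cont_on 0 pi v"
    and ode: "AE x in lebesgue_on {0<..<pi}. \<exists>u2. (v has_real_derivative u2) (at x) \<and> u2 + f x (u x) = 0"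
    and per0: "u 0 - u pi = 0" "v 0 - v pi = 0"
    using sol unfolding periodic_solution_def by blast
  then have per: "u 0 = u pi" "v 0 = v pi" by simp_all
  have cu: "continuous_on {0..pi} u" using u by (rule DERIV_continuous_on)
  define M where "M = {x \<in> {0<..<pi}. \<not> (\<exists>u2. (v has_real_derivative u2) (at x) \<and> u2 + f x (u x) = 0)} \<union> N \<union> {0, pi}"
  have M: "negligible M"
    unfolding M_def using ode f(1) by (auto simp: AE_lebesgue_on_iff_negligible)
  have deriv: "(v has_real_derivative - g x (u x)) (at x)" if xM: "x \<in> {0..pi} - M" for x
  proof -
    have x: "x \<in> {0<..<pi} - N" using xM by (auto simp: M_def less_le)
    then obtain u2 where "(v has_real_derivative u2) (at x)" "u2 + f x (u x) = 0"
      using xM by (auto simp: M_def)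
    moreover have "u2 = - g x (u x)" using calculation(2) f(2)[OF x] by simp
    ultimately show ?thesis by simp
  qed
  have "trajectory u v"
    unfolding trajectory_def
  proof (intro conjI ballI allI impI)
    fix s t :: real assume st: "0 \<le> s" "s \<le> t" "t \<le> pi"
    have "((\<lambda>x. - g x (u x)) has_integral v t - v s) {s..t}"
    proof (rule abs_cont_on_fundamental_theorem[OF st(2) _ M])
      show "abs_cont_on s t v"
        by (rule abs_cont_on_subinterval[OF v(2) st(1,3)])
      show "(v has_real_derivative - g x (u x)) (at x within {s..t})" if "x \<in> {s..t} - M" for x
        using deriv[of x] that st by (auto intro: has_field_derivative_at_within)
    qed
    from has_integral_neg[OF this]
    have "((\<lambda>x. g x (u x)) has_integral v s - v t) {s..t}" by simp
    then show "v s - v t = integral {s..t} (\<lambda>x. g x (u x))" by (simp add: integral_unique)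
  qed (use u v(1) in auto)
  with per show thesis by (intro that)
qed

end

section \<open>The periodic problem\<close>

text \<open>Extracts a nonnegative real bound from a condition on the extended-real essential supremum.\<close>

lemma Linf_norm_bound:
  assumes "0 < c" "0 < d" and less: "ereal c * Linf_norm p q \<beta> < ereal d"
  obtains M where "0 \<le> M" "M * c < d" "AE x in lebesgue_on {p<..<q}. \<bar>\<beta> x\<bar> \<le> M"
proof (cases "Linf_norm p q \<beta>")
  case (real M)
  have ae: "AE x in lebesgue_on {p<..<q}. ereal \<bar>\<beta> x\<bar> \<le> Linf_norm p q \<beta>"
    unfolding Linf_norm_def by (rule esssup_AE)
  show thesis
  proof (rule that[of "max 0 M"])
    show "max 0 M * c < d" using less assms(1,2) real by (auto simp: max_def mult.commute)
    show "AE x in lebesgue_on {p<..<q}. \<bar>\<beta> x\<bar> \<le> max 0 M"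
      using ae by eventually_elim (simp add: real)
  qed simp
next
  case PInf
  with less \<open>0 < c\<close> show thesis by simp
next
  case MInf
  have "AE x in lebesgue_on {p<..<q}. ereal \<bar>\<beta> x\<bar> \<le> Linf_norm p q \<beta>"
    unfolding Linf_norm_def by (rule esssup_AE)
  then have "AE x in lebesgue_on {p<..<q}. \<bar>\<beta> x\<bar> \<le> 0"
    by eventually_elim (simp add: MInf)
  with \<open>0 < d\<close> show thesis by (intro that[of 0]) auto
qed

lemma periodic_solution_cong:
  assumes sol: "periodic_solution f u" and eq: "\<And>x. x \<in> {0..pi} \<Longrightarrow> w x = u x"
  shows "periodic_solution f w"
proof -
  obtain v where v: "\<And>x. x \<in> {0..pi} \<Longrightarrow> (u has_real_derivative v x) (at x within {0..pi})"
    "continuous_on {0..pi} v" "abs_cont_on 0 pi v" "u 0 - u pi = 0" "v 0 - v pi = 0"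
    and ode: "AE x in lebesgue_on {0<..<pi}. \<exists>u2. (v has_real_derivative u2) (at x) \<and> u2 + f x (u x) = 0"
    using sol unfolding periodic_solution_def by blast
  have "(w has_real_derivative v x) (at x within {0..pi})" if "x \<in> {0..pi}" for x
    by (rule has_field_derivative_transform_within[OF v(1)[OF that] zero_less_one that]) (simp add: eq)
  moreover have "AE x in lebesgue_on {0<..<pi}. \<exists>u2. (v has_real_derivative u2) (at x) \<and> u2 + f x (w x) = 0"
  proof -
    have "AE x in lebesgue_on {0<..<pi}. x \<in> {0<..<pi}"
      by (rule AE_I2) (simp add: space_restrict_space)
    with ode show ?thesis by eventually_elim (use eq in auto)
  qed
  ultimately show ?thesis
    unfolding periodic_solution_def using v(2-5) eq[of 0] eq[of pi] by (intro exI[of _ v]) auto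
qed

lemma derivative_between_imp_slope_between:
  fixes F F' :: "real \<Rightarrow> real"
  assumes "\<And>w. (F has_real_derivative F' w) (at w)" "\<And>w. m \<le> F' w \<and> F' w \<le> M" "q \<le> p"
  shows "m * (p - q) \<le> F p - F q" "F p - F q \<le> M * (p - q)"
proof -
  have "m * (p - q) \<le> F p - F q \<and> F p - F q \<le> M * (p - q)"
  proof (cases "q = p")
    case False
    then obtain z where "F p - F q = (p - q) * F' z"
      using MVT2[of q p F F'] assms(1,3) by force
    then show ?thesis
      using assms(2)[of z] assms(3) by (simp add: mult.commute mult_right_mono)
  qed simp
  then show "m * (p - q) \<le> F p - F q" "F p - F q \<le> M * (p - q)" by auto
qed

theorem theorem4p8:
  fixes f f\<^sub>u :: "real \<Rightarrow> real \<Rightarrow> real"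
    and \<alpha> \<beta> :: "real \<Rightarrow> real"
    and x\<^sub>0 :: real
  assumes "\<And>x u. (f x has_real_derivative f\<^sub>u x u) (at u)"
    and "caratheodory f" and "caratheodory f\<^sub>u"
    and "\<And>x u. f (x + pi) u = f x u"
    and "\<alpha> \<in> Linf 0 pi" and "\<beta> \<in> Linf 0 pi"
    and "positive_on_period \<alpha>"
    and "AE x in lebesgue_on {0<..<pi}. \<forall>u. \<alpha> x \<le> f\<^sub>u x u \<and> f\<^sub>u x u \<le> \<beta> x"
    and "x\<^sub>0 \<in> {0<..<pi}"
    and "max (ereal (x\<^sub>0\<^sup>2) * Linf_norm 0 x\<^sub>0 \<beta>)
             (ereal ((pi - x\<^sub>0)\<^sup>2) * Linf_norm x\<^sub>0 pi \<beta>) < ereal (pi\<^sup>2)"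
  shows "\<exists>!u. u \<in> extensional {0..pi} \<and> periodic_solution f u"
proof -
  have x0: "0 < x\<^sub>0" "x\<^sub>0 < pi" using assms(9) by auto
  obtain k1 where k1: "0 \<le> k1" "k1 * x\<^sub>0\<^sup>2 < pi\<^sup>2" "AE x in lebesgue_on {0<..<x\<^sub>0}. \<bar>\<beta> x\<bar> \<le> k1"
    by (rule Linf_norm_bound[of "x\<^sub>0\<^sup>2" "pi\<^sup>2" 0 x\<^sub>0 \<beta>]) (use x0 assms(10) in auto)
  obtain k2 where k2: "0 \<le> k2" "k2 * (pi - x\<^sub>0)\<^sup>2 < pi\<^sup>2" "AE x in lebesgue_on {x\<^sub>0<..<pi}. \<bar>\<beta> x\<bar> \<le> k2"
    by (rule Linf_norm_bound[of "(pi - x\<^sub>0)\<^sup>2" "pi\<^sup>2" x\<^sub>0 pi \<beta>]) (use x0 assms(10) in auto)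
  obtain h where h: "set_integrable lebesgue {0..pi} h"
    and h_bound: "AE x in lebesgue. \<forall>u. \<bar>u\<bar> \<le> 1 \<longrightarrow> \<bar>f x u\<bar> \<le> h x"
    using assms(2) unfolding caratheodory_def by (meson zero_less_one)
  \<comment> \<open>All exceptional points of the hypotheses. Together with the Lipschitz property of \<open>f x\<close>, the bound
    for \<open>f x 0\<close> controls \<open>f x\<close> at every argument.\<close>
  define N where "N = {x \<in> {0<..<x\<^sub>0}. \<not> \<bar>\<beta> x\<bar> \<le> k1} \<union> {x \<in> {x\<^sub>0<..<pi}. \<not> \<bar>\<beta> x\<bar> \<le> k2}
    \<union> {x \<in> {0<..<pi}. \<not> (\<forall>u. \<alpha> x \<le> f\<^sub>u x u \<and> f\<^sub>u x u \<le> \<beta> x)} \<union> {x \<in> {0..pi}. \<not> 0 \<le> \<alpha> x}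
    \<union> {x \<in> UNIV. \<not> (\<forall>u. \<bar>u\<bar> \<le> 1 \<longrightarrow> \<bar>f x u\<bar> \<le> h x)} \<union> {x\<^sub>0}"
  have N: "negligible N"
    unfolding N_def
  proof (intro negligible_Un)
    show "negligible {x \<in> {0..pi}. \<not> 0 \<le> \<alpha> x}"
      using assms(7) unfolding positive_on_period_def by (simp add: AE_lebesgue_on_iff_negligible)
    show "negligible {x \<in> UNIV. \<not> (\<forall>u. \<bar>u\<bar> \<le> 1 \<longrightarrow> \<bar>f x u\<bar> \<le> h x)}"
    proof (rule AE_lebesgue_on_iff_negligible[THEN iffD1])
      show "AE x in lebesgue_on UNIV. \<forall>u. \<bar>u\<bar> \<le> 1 \<longrightarrow> \<bar>f x u\<bar> \<le> h x"
        using h_bound by (simp add: AE_restrict_space_iff)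
    qed simp
    show "negligible {x \<in> {0<..<x\<^sub>0}. \<not> \<bar>\<beta> x\<bar> \<le> k1}"
      by (rule AE_lebesgue_on_iff_negligible[THEN iffD1, OF _ k1(3)]) simp
    show "negligible {x \<in> {x\<^sub>0<..<pi}. \<not> \<bar>\<beta> x\<bar> \<le> k2}"
      by (rule AE_lebesgue_on_iff_negligible[THEN iffD1, OF _ k2(3)]) simp
    show "negligible {x \<in> {0<..<pi}. \<not> (\<forall>u. \<alpha> x \<le> f\<^sub>u x u \<and> f\<^sub>u x u \<le> \<beta> x)}"
      by (rule AE_lebesgue_on_iff_negligible[THEN iffD1, OF _ assms(8)]) simp
  qed simp
  define S where "S = {0<..<pi} - N"
  have S_sets: "S \<in> sets lebesgue"
    unfolding S_def using negligible_imp_sets[OF N] by auto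
  have S_null: "negligible ({0<..<pi} - S)"
    by (rule negligible_subset[OF N]) (auto simp: S_def)
  have S: "0 \<le> \<alpha> x" "\<And>u. \<alpha> x \<le> f\<^sub>u x u" "\<And>u. f\<^sub>u x u \<le> \<beta> x" "x \<noteq> x\<^sub>0" "\<bar>f x 0\<bar> \<le> h x"
    "\<beta> x \<le> (if x < x\<^sub>0 then k1 else k2)" if "x \<in> S" for x
  proof -
    show "0 \<le> \<alpha> x" "\<And>u. \<alpha> x \<le> f\<^sub>u x u" "\<And>u. f\<^sub>u x u \<le> \<beta> x" "x \<noteq> x\<^sub>0" "\<bar>f x 0\<bar> \<le> h x"
      using that by (auto simp: S_def N_def)
    show "\<beta> x \<le> (if x < x\<^sub>0 then k1 else k2)"
      using that by (cases x x\<^sub>0 rule: linorder_cases) (auto simp: S_def N_def abs_le_iff)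
  qed
  \<comment> \<open>Capping at \<open>1\<close> keeps \<open>\<alpha>\<close> measurable, and positive where it was, and makes it bounded.\<close>
  define a where "a = (\<lambda>x. if x \<in> S then min 1 (\<alpha> x) else 0)"
  interpret two_step_bound a "x\<^sub>0" k1 k2
  proof
    show "0 < x\<^sub>0" "x\<^sub>0 < pi" by fact+
    show "k1 * x\<^sub>0\<^sup>2 < pi\<^sup>2" "k2 * (pi - x\<^sub>0)\<^sup>2 < pi\<^sup>2" by fact+
    show "a \<in> borel_measurable lebesgue"
    proof -
      have "\<alpha> \<in> borel_measurable (lebesgue_on {0<..<pi})"
        using assms(5) by (simp add: Linf_def)
      then have "\<alpha> \<in> borel_measurable (lebesgue_on S)"
        by (rule measurable_restrict_mono) (auto simp: S_def)
      then have "(\<lambda>x. min 1 (\<alpha> x)) \<in> borel_measurable (lebesgue_on S)" by measurable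
      then show ?thesis
        unfolding a_def by (rule borel_measurable_if[OF S_sets, THEN iffD2])
    qed
    show "0 \<le> a x" for x using S(1)[of x] by (simp add: a_def)
    have a_le: "a x \<le> (if x < x\<^sub>0 then k1 else k2)" for x
    proof (cases "x \<in> S")
      case True
      have "a x \<le> \<alpha> x" using True by (simp add: a_def)
      also have "\<dots> \<le> \<beta> x" using S(2,3)[OF True] by (rule order_trans)
      also note S(6)[OF True]
      finally show ?thesis .
    qed (simp add: a_def k1(1) k2(1))
    show "a x \<le> k1" if "x < x\<^sub>0" for x using a_le[of x] that by simp
    show "a x \<le> k2" if "x\<^sub>0 \<le> x" for x using a_le[of x] that by simp
    show "\<not> negligible {x \<in> {0..pi}. 0 < a x}"
    proof
      assume "negligible {x \<in> {0..pi}. 0 < a x}"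
      then have "negligible ({x \<in> {0..pi}. 0 < a x} \<union> N \<union> {0, pi})"
        using N by (intro negligible_Un) auto
      then have "negligible {x \<in> {0..pi}. 0 < \<alpha> x}"
        by (rule negligible_subset) (auto simp: a_def S_def less_le)
      then have "emeasure lebesgue {x \<in> {0..pi}. 0 < \<alpha> x} = 0"
        by (simp add: negligible_iff_null_sets null_setsD1)
      with assms(7) show False by (simp add: positive_on_period_def)
    qed
  qed
  \<comment> \<open>At exceptional points \<open>f\<close> is replaced by a linear function with an allowed slope, so that the slope
    conditions hold everywhere.\<close>
  define g where "g = (\<lambda>x w. if x \<in> S then f x w else k x * w)"
  interpret monotone_nonlinearity a "x\<^sub>0" k1 k2 g
  proof
    show "(\<lambda>x. g x w) \<in> borel_measurable lebesgue" for w
    proof -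
      have "(\<lambda>x. f x w) \<in> borel_measurable lebesgue"
        using assms(2) by (simp add: caratheodory_def)
      moreover have "(\<lambda>x. k x * w) \<in> borel_measurable lebesgue"
        using k_measurable by measurable
      ultimately show ?thesis
        unfolding g_def using S_sets by (intro measurable_If_set) auto
    qed
    fix x p q :: real assume "q \<le> p"
    show "a x * (p - q) \<le> g x p - g x q"
    proof (cases "x \<in> S")
      case True
      have "a x * (p - q) \<le> \<alpha> x * (p - q)"
        using True \<open>q \<le> p\<close> by (intro mult_right_mono) (auto simp: a_def)
      also have "\<dots> \<le> f x p - f x q"
        by (rule derivative_between_imp_slope_between(1)[OF assms(1), where m="\<alpha> x" and M="\<beta> x"])
          (simp_all add: S(2,3)[OF True] \<open>q \<le> p\<close>)
      finally show ?thesis using True by (simp add: g_def)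
    next
      case False
      then show ?thesis using \<open>q \<le> p\<close> k_bounds(1)[of x] by (simp add: g_def a_def mult_left_mono)
    qed
    show "g x p - g x q \<le> k x * (p - q)"
    proof (cases "x \<in> S")
      case True
      have "f x p - f x q \<le> \<beta> x * (p - q)"
        by (rule derivative_between_imp_slope_between(2)[OF assms(1), where m="\<alpha> x" and M="\<beta> x"])
          (simp_all add: S(2,3)[OF True] \<open>q \<le> p\<close>)
      also have "\<dots> \<le> k x * (p - q)"
        using S(6)[OF True] \<open>q \<le> p\<close> by (intro mult_right_mono) (auto simp: k_def)
      finally show ?thesis using True by (simp add: g_def)
    qed (simp add: g_def right_diff_distrib)
  next
    show "(\<lambda>x. g x 0) absolutely_integrable_on {0..pi}"
    proof (rule measurable_bounded_by_integrable_imp_absolutely_integrable)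
      have "(\<lambda>x. f x 0) \<in> borel_measurable lebesgue"
        using assms(2) by (simp add: caratheodory_def)
      then have "(\<lambda>x. g x 0) \<in> borel_measurable lebesgue"
        unfolding g_def using S_sets by (intro measurable_If_set) auto
      then show "(\<lambda>x. g x 0) \<in> borel_measurable (lebesgue_on {0..pi})"
        by (rule measurable_restrict_space1)
      show "(\<lambda>x. \<bar>h x\<bar>) integrable_on {0..pi}"
        using h by (auto simp: absolutely_integrable_on_def)
      show "norm (g x 0) \<le> \<bar>h x\<bar>" if "x \<in> {0..pi}" for x
        using S(5)[of x] by (auto simp: g_def)
    qed simp
  qed
  have fg: "f x w = g x w" if "x \<in> {0<..<pi} - ({0<..<pi} - S)" for x w
    using that by (simp add: g_def)
  obtain u v where uv: "trajectory u v" "u 0 = u pi" "v 0 = v pi"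
    by (rule periodic_trajectory_exists)
  show ?thesis
  proof (rule ex1I)
    have "periodic_solution f u"
      by (rule trajectory_imp_periodic_solution[OF uv S_null fg])
    then show "restrict u {0..pi} \<in> extensional {0..pi} \<and> periodic_solution f (restrict u {0..pi})"
      by (auto intro: periodic_solution_cong)
    fix w assume w: "w \<in> extensional {0..pi} \<and> periodic_solution f w"
    obtain v' where v': "trajectory w v'" "w 0 = w pi" "v' 0 = v' pi"
      by (rule periodic_solution_imp_trajectory[OF conjunct2[OF w] S_null fg])
    show "w = restrict u {0..pi}"
    proof (rule extensionalityI[of _ "{0..pi}"])
      show "w x = restrict u {0..pi} x" if "x \<in> {0..pi}" for x
        using periodic_trajectory_unique[OF v' uv that] that by simp
    qed (use w in auto)
  qed
qed

end
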